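(* The complex parallelizable Nakamura manifold $\Gamma\backslash G$ does not admit astheno-Kähler metrics.
   Context: Let $G=\mathbb{C}\ltimes_\phi\mathbb{C}^2$ be the semidirect product defined by $\phi(z)=\begin{pmatrix}e^z&0\\0&e^{-z}\end{pmatrix}$. Let $a+bi,\ c+di\in\mathbb{C}$ (with $a,b,c,d\in\mathbb R$) be such that $\mathbb{Z}(a+bi)+\mathbb{Z}(c+di)$ is a lattice in $\mathbb{C}$ and $\phi(a+bi)$, $\phi(c+di)$ are conjugate to elements of $SL(4;\mathbb{Z})$, where $SL(2;\mathbb{C})$ is regarded as a subgroup of $SL(4;\mathbb{R})$. Then there is a lattice $\Gamma=\left(\mathbb{Z}(a+bi)+\mathbb{Z}(c+di)\right)\ltimes_\phi\Gamma''$ of $G$, where $\Gamma''$ is a lattice of $\mathbb{C}^2$. The compact complex manifold $\Gamma\backslash G$ is called the complex parallelizable Nakamura manifold. On a complex manifold of complex dimension $n$, a Hermitian metric with fundamental $(1,1)$-form $\omega$ is called astheno-Kähler if $\partial\bar\partial\omega^{n-2}=0$. *)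

theory Defs
  imports "HOL-Analysis.Analysis" "HOL-Algebra.Coset"
begin

section \<open>Smooth functions and differential forms on open subsets of \<open>\<complex>\<^sup>n\<close>\<close>

text \<open>\<open>C\<^sup>k\<close>-regularity; meaningful for open \<open>S\<close> only.\<close>

primrec C_k_on :: "nat \<Rightarrow> ('a::real_normed_vector \<Rightarrow> 'b::real_normed_vector) \<Rightarrow> 'a set \<Rightarrow> bool" where
  "C_k_on 0 f S \<longleftrightarrow> continuous_on S f"
| "C_k_on (Suc k) f S \<longleftrightarrow> (\<forall>x\<in>S. f differentiable (at x)) \<and>
     (\<forall>v. C_k_on k (\<lambda>x. frechet_derivative f (at x) v) S)"

definition smooth_on :: "('a::real_normed_vector \<Rightarrow> 'b::real_normed_vector) \<Rightarrow> 'a set \<Rightarrow> bool" where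
  "smooth_on f S \<longleftrightarrow> (\<forall>k. C_k_on k f S)"

text \<open>Wirtinger derivatives $\partial f / \partial z_j$ and $\partial f / \partial \bar z_j$, with
  \<open>axis j 1\<close> and \<open>axis j \<i>\<close> the real coordinate directions \<open>x\<^sub>j\<close> and \<open>y\<^sub>j\<close>.\<close>

definition d_z :: "'n::finite \<Rightarrow> (complex^'n \<Rightarrow> complex) \<Rightarrow> complex^'n \<Rightarrow> complex" where
  "d_z j f x = (frechet_derivative f (at x) (axis j 1)
                - \<i> * frechet_derivative f (at x) (axis j \<i>)) / 2"

definition d_zbar :: "'n::finite \<Rightarrow> (complex^'n \<Rightarrow> complex) \<Rightarrow> complex^'n \<Rightarrow> complex" where
  "d_zbar j f x = (frechet_derivative f (at x) (axis j 1)
                   + \<i> * frechet_derivative f (at x) (axis j \<i>)) / 2"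

type_synonym 'n cvec = "complex^'n"
type_synonym 'n cmat = "complex^'n^'n"

text \<open>A complex differential form is given by its coefficients: \<open>\<alpha> I J\<close> is the coefficient of
  \<open>dz\<^sub>I \<and> d\<close>$\bar z_J$, where \<open>dz\<^sub>I\<close> is the wedge product of the \<open>dz\<^sub>i\<close>, \<open>i \<in> I\<close>, in increasing order
  of \<open>i\<close>, and similarly for $d\bar z_J$.\<close>

type_synonym 'n cform = "'n set \<Rightarrow> 'n set \<Rightarrow> 'n cvec \<Rightarrow> complex"

text \<open>For disjoint \<open>I\<close> and \<open>K\<close>, \<open>dz\<^sub>I \<and> dz\<^sub>K = shuffle_sign I K \<cdot> dz\<close> indexed by \<open>I \<union> K\<close>.\<close>

definition shuffle_sign :: "'n::linorder set \<Rightarrow> 'n set \<Rightarrow> complex" where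
  "shuffle_sign I K = (- 1) ^ card {(i, k). i \<in> I \<and> k \<in> K \<and> k < i}"

text \<open>The factor \<open>(- 1) ^ (card J' * card (I - I'))\<close> comes from moving \<open>dz\<close> indexed by \<open>I - I'\<close>
  past $d\bar z_{J'}$.\<close>

definition wedge :: "('n::{finite,linorder}) cform \<Rightarrow> 'n cform \<Rightarrow> 'n cform" where
  "wedge \<alpha> \<beta> = (\<lambda>I J x. \<Sum>I'\<in>Pow I. \<Sum>J'\<in>Pow J.
      (- 1) ^ (card J' * card (I - I')) * shuffle_sign I' (I - I') * shuffle_sign J' (J - J')
      * \<alpha> I' J' x * \<beta> (I - I') (J - J') x)"

definition unit_form :: "('n::{finite,linorder}) cform" where
  "unit_form = (\<lambda>I J x. if I = {} \<and> J = {} then 1 else 0)"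

primrec wedge_power :: "('n::{finite,linorder}) cform \<Rightarrow> nat \<Rightarrow> 'n cform" where
  "wedge_power \<alpha> 0 = unit_form"
| "wedge_power \<alpha> (Suc m) = wedge \<alpha> (wedge_power \<alpha> m)"

text \<open>\<open>\<partial>\<alpha> = \<Sum>\<^sub>i dz\<^sub>i \<and> \<partial>\<alpha>/\<partial>z\<^sub>i\<close> and $\bar\partial\alpha = \sum_j d\bar z_j \wedge \partial\alpha/\partial\bar z_j$.\<close>

definition del :: "('n::{finite,linorder}) cform \<Rightarrow> 'n cform" where
  "del \<alpha> = (\<lambda>I J x. \<Sum>i\<in>I. shuffle_sign {i} (I - {i}) * d_z i (\<alpha> (I - {i}) J) x)"

definition delbar :: "('n::{finite,linorder}) cform \<Rightarrow> 'n cform" where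
  "delbar \<alpha> = (\<lambda>I J x. \<Sum>j\<in>J.
      (- 1) ^ card I * shuffle_sign {j} (J - {j}) * d_zbar j (\<alpha> I (J - {j})) x)"

text \<open>The \<open>(1,1)\<close>-form $\frac{i}{2} \sum_{j,k} h_{jk}\, dz_j \wedge d\bar z_k$ of the Hermitian metric
  $\sum_{j,k} h_{jk}\, dz_j \otimes d\bar z_k$.\<close>

definition fundamental_form ::
  "(('n::{finite,linorder}) cvec \<Rightarrow> 'n cmat) \<Rightarrow> 'n cform" where
  "fundamental_form h = (\<lambda>I J x.
     if card I = 1 \<and> card J = 1 then \<i> / 2 * h x $ the_elem I $ the_elem J else 0)"


section \<open>Complex manifolds and Hermitian metrics\<close>

type_synonym ('p, 'n) chart = "'p set \<times> ('p \<Rightarrow> 'n cvec)"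

text \<open>The change of coordinates from the chart \<open>c\<close> to the chart \<open>c'\<close>.\<close>

definition transition :: "('p, 'n::finite) chart \<Rightarrow> ('p, 'n) chart \<Rightarrow> 'n cvec \<Rightarrow> 'n cvec" where
  "transition c c' = snd c' \<circ> inv_into (fst c) (snd c)"

text \<open>The derivative of a transition map has to be \<open>\<complex>\<close>-linear, i.e. given by a complex matrix.\<close>

definition complex_manifold :: "'p topology \<Rightarrow> ('p, 'n::finite) chart set \<Rightarrow> bool" where
  "complex_manifold X A \<longleftrightarrow>
     Hausdorff_space X \<and>
     (\<exists>\<B>. countable \<B> \<and> (\<forall>B\<in>\<B>. openin X B) \<and>
        (\<forall>U. openin X U \<longrightarrow> (\<exists>\<C>\<subseteq>\<B>. U = \<Union>\<C>))) \<and>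
     topspace X = (\<Union>c\<in>A. fst c) \<and>
     (\<forall>c\<in>A. openin X (fst c) \<and> open (snd c ` fst c) \<and>
        homeomorphic_map (subtopology X (fst c)) (top_of_set (snd c ` fst c)) (snd c)) \<and>
     (\<forall>c\<in>A. \<forall>c'\<in>A. \<forall>x\<in>snd c ` (fst c \<inter> fst c').
        \<exists>J::'n cmat. (transition c c' has_derivative (\<lambda>v. J *v v)) (at x))"

definition hermitian_posdef :: "('n::finite) cmat \<Rightarrow> bool" where
  "hermitian_posdef H \<longleftrightarrow> (\<forall>j k. H $ k $ j = cnj (H $ j $ k)) \<and>
     (\<forall>v. v \<noteq> 0 \<longrightarrow> 0 < Re (\<Sum>j\<in>UNIV. \<Sum>k\<in>UNIV. H $ j $ k * v $ j * cnj (v $ k)))"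

text \<open>A Hermitian metric is given by its matrix \<open>h c\<close> in each chart \<open>c\<close>; the matrices are related by
  the transformation rule of $\sum_{j,k} h_{jk}\, dz_j \otimes d\bar z_k$.\<close>

definition hermitian_metric ::
  "('p, 'n::finite) chart set \<Rightarrow> (('p, 'n) chart \<Rightarrow> 'n cvec \<Rightarrow> 'n cmat) \<Rightarrow> bool"
  where
  "hermitian_metric A h \<longleftrightarrow>
     (\<forall>c\<in>A. smooth_on (h c) (snd c ` fst c) \<and> (\<forall>x\<in>snd c ` fst c. hermitian_posdef (h c x))) \<and>
     (\<forall>c\<in>A. \<forall>c'\<in>A. \<forall>p\<in>fst c \<inter> fst c'.
        let J = jacobian (transition c c') (at (snd c p))
        in h c (snd c p) = transpose J ** h c' (snd c' p) ** (\<chi> j k. cnj (J $ j $ k)))"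

definition astheno_kaehler ::
  "('p, 'n::{finite,linorder}) chart set \<Rightarrow> (('p, 'n) chart \<Rightarrow> 'n cvec \<Rightarrow> 'n cmat) \<Rightarrow> bool"
  where
  "astheno_kaehler A h \<longleftrightarrow> hermitian_metric A h \<and>
     (\<forall>c\<in>A. \<forall>x\<in>snd c ` fst c. \<forall>I J.
        del (delbar (wedge_power (fundamental_form (h c)) (CARD('n) - 2))) I J x = 0)"


section \<open>Lattices and quotients\<close>

definition vector_lattice :: "'a::euclidean_space set \<Rightarrow> bool" where
  "vector_lattice L \<longleftrightarrow> (\<exists>B. independent B \<and> span B = UNIV \<and>
     L = {\<Sum>b\<in>B. of_int (k b) *\<^sub>R b | k :: 'a \<Rightarrow> int. True})"

text \<open>The quotient topology on \<open>\<Gamma>\G\<close>, whose points are the cosets \<open>\<Gamma>g\<close>; \<open>G\<close> carries the topology of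
  its ambient type.\<close>

definition coset_topology ::
  "('g::topological_space, 'm) monoid_scheme \<Rightarrow> 'g set \<Rightarrow> 'g set topology" where
  "coset_topology G \<Gamma> = topology (\<lambda>U. U \<subseteq> rcosets\<^bsub>G\<^esub> \<Gamma> \<and>
     openin (top_of_set (carrier G)) {g \<in> carrier G. \<Gamma> #>\<^bsub>G\<^esub> g \<in> U})"

lemma openin_coset_topology:
  "openin (coset_topology G \<Gamma>) U \<longleftrightarrow> U \<subseteq> rcosets\<^bsub>G\<^esub> \<Gamma> \<and>
     openin (top_of_set (carrier G)) {g \<in> carrier G. \<Gamma> #>\<^bsub>G\<^esub> g \<in> U}"
proof -
  let ?P = "\<lambda>U. {g \<in> carrier G. \<Gamma> #>\<^bsub>G\<^esub> g \<in> U}"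
  have "?P (S \<inter> T) = ?P S \<inter> ?P T" and "?P (\<Union>\<K>) = (\<Union>K\<in>\<K>. ?P K)" for S T \<K>
    by auto
  then have "istopology (\<lambda>U. U \<subseteq> rcosets\<^bsub>G\<^esub> \<Gamma> \<and> openin (top_of_set (carrier G)) (?P U))"
    unfolding istopology_def by (auto intro!: openin_Int openin_Union)
  then show ?thesis
    by (simp add: coset_topology_def topology_inverse')
qed

definition group_lattice :: "('g::topological_space, 'm) monoid_scheme \<Rightarrow> 'g set \<Rightarrow> bool" where
  "group_lattice G \<Gamma> \<longleftrightarrow>
     subgroup \<Gamma> G \<and> discrete \<Gamma> \<and> compact_space (coset_topology G \<Gamma>)"


section \<open>The complex parallelizable Nakamura manifold\<close>

definition semidirect :: "(complex \<Rightarrow> 2 cmat) \<Rightarrow> (complex \<times> 2 cvec) monoid" where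
  "semidirect \<phi> = \<lparr>carrier = UNIV,
     mult = (\<lambda>(z, w) (z', w'). (z + z', w + \<phi> z *v w')),
     one = (0, 0)\<rparr>"

definition nakamura_phi :: "complex \<Rightarrow> 2 cmat" where
  "nakamura_phi z = vector [vector [exp z, 0], vector [0, exp (- z)]]"

abbreviation nakamura_group :: "(complex \<times> 2 cvec) monoid" where
  "nakamura_group \<equiv> semidirect nakamura_phi"

definition int_span2 :: "complex \<Rightarrow> complex \<Rightarrow> complex set" where
  "int_span2 u v = {of_int m * u + of_int n * v | m n :: int. True}"

text \<open>The embedding of complex \<open>2 \<times> 2\<close> into real \<open>4 \<times> 4\<close> matrices induced by identifying
  \<open>(x\<^sub>1 + \<i> y\<^sub>1, x\<^sub>2 + \<i> y\<^sub>2)\<close> with \<open>(x\<^sub>1, y\<^sub>1, x\<^sub>2, y\<^sub>2)\<close>.\<close>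

definition realification :: "2 cmat \<Rightarrow> real^4^4" where
  "realification M = vector
    [vector [Re (M$1$1), - Im (M$1$1), Re (M$1$2), - Im (M$1$2)],
     vector [Im (M$1$1),   Re (M$1$1), Im (M$1$2),   Re (M$1$2)],
     vector [Re (M$2$1), - Im (M$2$1), Re (M$2$2), - Im (M$2$2)],
     vector [Im (M$2$1),   Re (M$2$1), Im (M$2$2),   Re (M$2$2)]]"

definition conjugate_into_SL4Z :: "2 cmat \<Rightarrow> bool" where
  "conjugate_into_SL4Z M \<longleftrightarrow> (\<exists>(P::real^4^4) (N::real^4^4). invertible P \<and>
     (\<forall>i j. N $ i $ j \<in> \<int>) \<and> det N = 1 \<and> N = P ** realification M ** matrix_inv P)"

text \<open>The complex manifold structure on \<open>\<Gamma>\G\<close> making \<open>G \<rightarrow> \<Gamma>\G\<close> locally biholomorphic: its charts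
  are the inverses of the restrictions of the projection to open sets on which it is injective,
  followed by the global coordinates \<open>(z, w\<^sub>1, w\<^sub>2)\<close> of \<open>G\<close>.\<close>

definition nakamura_coords :: "complex \<times> 2 cvec \<Rightarrow> 3 cvec" where
  "nakamura_coords = (\<lambda>(z, w). vector [z, w $ 1, w $ 2])"

definition nakamura_proj :: "(complex \<times> 2 cvec) set \<Rightarrow> complex \<times> 2 cvec \<Rightarrow> (complex \<times> 2 cvec) set" where
  "nakamura_proj \<Gamma> g = \<Gamma> #>\<^bsub>nakamura_group\<^esub> g"

definition nakamura_atlas ::
  "(complex \<times> 2 cvec) set \<Rightarrow> ((complex \<times> 2 cvec) set, 3) chart set" where
  "nakamura_atlas \<Gamma> =
     {(nakamura_proj \<Gamma> ` V, nakamura_coords \<circ> inv_into V (nakamura_proj \<Gamma>)) | V.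
        open V \<and> inj_on (nakamura_proj \<Gamma>) V}"


section \<open>The atlas is a complex structure and carries Hermitian metrics\<close>

text \<open>For every discrete subgroup \<open>\<Gamma>\<close>, lemma \<open>complex_manifold_nakamura\<close> says that \<open>\<Gamma>\G\<close> is a complex
  manifold, and \<open>hermitian_metric_invariant_metric\<close> that the left-invariant metric
  $|dz|^2 + |e^{-z} dw_1|^2 + |e^z dw_2|^2$ of \<open>G\<close> descends to it.\<close>

lemma nakamura_phi_mult: "nakamura_phi z *v w = vector [exp z * w $ 1, exp (- z) * w $ 2]"
  by (simp add: vec_eq_iff forall_2 matrix_vector_mult_def sum_2 nakamura_phi_def)

definition nakamura_mult :: "complex \<times> 2 cvec \<Rightarrow> complex \<times> 2 cvec \<Rightarrow> complex \<times> 2 cvec" where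
  "nakamura_mult g h = (fst g + fst h, snd g + nakamura_phi (fst g) *v snd h)"
definition nakamura_inverse :: "complex \<times> 2 cvec \<Rightarrow> complex \<times> 2 cvec" where
  "nakamura_inverse g = (- fst g, - (nakamura_phi (- fst g) *v snd g))"

lemma nakamura_group_simps [simp]:
  "carrier nakamura_group = UNIV"
  "g \<otimes>\<^bsub>nakamura_group\<^esub> h = nakamura_mult g h"
  "\<one>\<^bsub>nakamura_group\<^esub> = (0, 0)"
  by (simp_all add: semidirect_def nakamura_mult_def split: prod.splits)

lemma nakamura_mult_assoc: "nakamura_mult (nakamura_mult x y) z = nakamura_mult x (nakamura_mult y z)"
  by (simp add: nakamura_mult_def nakamura_phi_mult vec_eq_iff forall_2 exp_add exp_diff exp_minus algebra_simps divide_inverse)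
lemma nakamura_mult_inverse: "nakamura_mult (nakamura_inverse x) x = (0, 0)"
  by (simp add: nakamura_mult_def nakamura_inverse_def nakamura_phi_mult vec_eq_iff forall_2 zero_prod_def)
lemma nakamura_mult_one: "nakamura_mult (0,0) x = x"
  by (cases x) (simp add: nakamura_mult_def nakamura_phi_mult vec_eq_iff forall_2)

lemma group_nakamura: "group nakamura_group"
proof (rule groupI)
  fix x
  show "\<exists>y\<in>carrier nakamura_group. y \<otimes>\<^bsub>nakamura_group\<^esub> x = \<one>\<^bsub>nakamura_group\<^esub>"
    using nakamura_mult_inverse[of x] by (intro bexI[of _ "nakamura_inverse x"]) simp_all
qed (simp_all add: nakamura_mult_assoc nakamura_mult_one)

interpretation nakamura: group nakamura_group by (rule group_nakamura)

lemma inv_nakamura [simp]: "inv\<^bsub>nakamura_group\<^esub> x = nakamura_inverse x"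
  by (rule group.inv_equality[OF group_nakamura]) (simp_all add: nakamura_mult_inverse)

lemma continuous_nakamura_phi: 
  assumes "continuous_on UNIV f" "continuous_on UNIV g"
  shows "continuous_on UNIV (\<lambda>x::'a::topological_space. nakamura_phi (f x) *v g x)"
proof -
  have "(\<lambda>x. nakamura_phi (f x) *v g x) = 
     (\<lambda>x. (\<chi> i. if i = 1 then exp (f x) * g x $ 1 else exp (- f x) * g x $ 2))"
    by (auto simp: nakamura_phi_mult vec_eq_iff forall_2 fun_eq_iff)
  moreover have "continuous_on UNIV (\<lambda>x. (\<chi> i::2. if i = 1 then exp (f x) * g x $ 1 else exp (- f x) * g x $ 2))"
    using assms
    apply (intro continuous_on_vec_lambda)
    subgoal for i by (cases "i = 1") (auto intro!: continuous_intros)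
    done
  ultimately show ?thesis by (simp only:)
qed

lemma continuous_nakamura_mult: "continuous_on UNIV f \<Longrightarrow> continuous_on UNIV g \<Longrightarrow> continuous_on UNIV (\<lambda>x::'a::topological_space. nakamura_mult (f x) (g x))"
  unfolding nakamura_mult_def by (intro continuous_intros continuous_nakamura_phi) auto

lemma continuous_nakamura_inverse: "continuous_on UNIV f \<Longrightarrow> continuous_on UNIV (\<lambda>x::'a::topological_space. nakamura_inverse (f x))"
  unfolding nakamura_inverse_def by (intro continuous_intros continuous_nakamura_phi) auto

context
  fixes \<Gamma> assumes sub: "subgroup \<Gamma> nakamura_group" and disc: "discrete \<Gamma>"
begin
lemma nakamura_proj_eq_iff: "nakamura_proj \<Gamma> x = nakamura_proj \<Gamma> y \<longleftrightarrow> nakamura_mult x (nakamura_inverse y) \<in> \<Gamma>"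
proof -
  have "x \<in> \<Gamma> #>\<^bsub>nakamura_group\<^esub> y \<longleftrightarrow> nakamura_mult x (nakamura_inverse y) \<in> \<Gamma>"
    using subgroup.rcos_module[OF sub group_nakamura, of y x] by simp
  moreover have "x \<in> \<Gamma> #>\<^bsub>nakamura_group\<^esub> y \<longleftrightarrow> nakamura_proj \<Gamma> x = nakamura_proj \<Gamma> y"
    unfolding nakamura_proj_def
    by (metis nakamura.repr_independence nakamura.rcos_self sub nakamura_group_simps(1) UNIV_I)
  ultimately show ?thesis by simp
qed

lemma nakamura_proj_eq_iff_ex: "nakamura_proj \<Gamma> x = nakamura_proj \<Gamma> y \<longleftrightarrow> (\<exists>\<gamma>\<in>\<Gamma>. x = nakamura_mult \<gamma> y)"
proof
  assume "nakamura_proj \<Gamma> x = nakamura_proj \<Gamma> y"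
  then have "nakamura_mult x (nakamura_inverse y) \<in> \<Gamma>" by (simp add: nakamura_proj_eq_iff)
  moreover have "x = nakamura_mult (nakamura_mult x (nakamura_inverse y)) y"
    by (metis nakamura.inv_solve_right UNIV_I inv_nakamura nakamura_group_simps(1,2))
  ultimately show "\<exists>\<gamma>\<in>\<Gamma>. x = nakamura_mult \<gamma> y" by blast
next
  assume "\<exists>\<gamma>\<in>\<Gamma>. x = nakamura_mult \<gamma> y"
  then obtain \<gamma> where "\<gamma> \<in> \<Gamma>" "x = nakamura_mult \<gamma> y" by blast
  moreover then have "nakamura_mult x (nakamura_inverse y) = \<gamma>"
    by (metis nakamura.inv_solve_right UNIV_I inv_nakamura nakamura_group_simps(1,2))
  ultimately show "nakamura_proj \<Gamma> x = nakamura_proj \<Gamma> y" by (simp add: nakamura_proj_eq_iff)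
qed

lemma open_nakamura_saturation: "open V \<Longrightarrow> open {g. nakamura_proj \<Gamma> g \<in> nakamura_proj \<Gamma> ` V}"
proof -
  assume V: "open V"
  have "{g. nakamura_proj \<Gamma> g \<in> nakamura_proj \<Gamma> ` V} = (\<Union>\<gamma>\<in>\<Gamma>. (\<lambda>g. nakamura_mult \<gamma> g) -` V)"
  proof -
    have "nakamura_proj \<Gamma> g \<in> nakamura_proj \<Gamma> ` V \<longleftrightarrow> (\<exists>\<gamma>\<in>\<Gamma>. nakamura_mult \<gamma> g \<in> V)" for g
      using nakamura_proj_eq_iff_ex by (metis (no_types, lifting) imageE imageI)
    then show ?thesis by (simp add: set_eq_iff)
  qed
  moreover have "open ((\<lambda>g. nakamura_mult \<gamma> g) -` V)" for \<gamma>
    by (intro open_vimage V continuous_nakamura_mult continuous_intros)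
  ultimately show ?thesis by auto
qed

lemma rcosets_nakamura: "rcosets\<^bsub>nakamura_group\<^esub> \<Gamma> = range (nakamura_proj \<Gamma>)"
  by (auto simp: RCOSETS_def nakamura_proj_def)

lemma openin_nakamura_topology: "openin (coset_topology nakamura_group \<Gamma>) U \<longleftrightarrow> U \<subseteq> range (nakamura_proj \<Gamma>) \<and> open {g. nakamura_proj \<Gamma> g \<in> U}"
  by (simp add: openin_coset_topology rcosets_nakamura nakamura_proj_def)

lemma openin_nakamura_proj_image: "open V \<Longrightarrow> openin (coset_topology nakamura_group \<Gamma>) (nakamura_proj \<Gamma> ` V)"
  by (auto simp: openin_nakamura_topology open_nakamura_saturation)

lemma topspace_nakamura_topology: "topspace (coset_topology nakamura_group \<Gamma>) = range (nakamura_proj \<Gamma>)"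
proof -
  have "openin (coset_topology nakamura_group \<Gamma>) (range (nakamura_proj \<Gamma>))" by (rule openin_nakamura_proj_image) simp
  then show ?thesis using openin_nakamura_topology by (metis openin_subset openin_topspace subset_antisym)
qed

lemma nakamura_discrete_nbhd: obtains N where "open N" "(0,0) \<in> N" "\<And>x y. x \<in> N \<Longrightarrow> y \<in> N \<Longrightarrow> nakamura_mult x (nakamura_inverse y) \<in> \<Gamma> \<Longrightarrow> x = y"
proof -
  have "(0,0) \<in> \<Gamma>" using subgroup.one_closed[OF sub] by simp
  then obtain T where T: "open T" "T \<inter> \<Gamma> = {(0,0)}"
    using disc unfolding discrete_def isolated_in_def by blast
  let ?f = "\<lambda>p. nakamura_mult (fst p) (nakamura_inverse (snd p))"
  have "open (?f -` T)"
    by (intro open_vimage T continuous_nakamura_mult continuous_nakamura_inverse continuous_intros)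
  moreover have "((0,0),(0,0)) \<in> ?f -` T"
  proof -
    have "nakamura_inverse (0,0) = (0,0)" using nakamura.inv_one by simp
    then show ?thesis using T(2) by (auto simp: nakamura_mult_one)
  qed
  ultimately obtain A B where AB: "open A" "open B" "((0,0),(0,0)) \<in> A \<times> B" "A \<times> B \<subseteq> ?f -` T"
    by (rule open_prod_elim)
  show ?thesis
  proof (rule that[of "A \<inter> B"])
    fix x y assume "x \<in> A \<inter> B" "y \<in> A \<inter> B" "nakamura_mult x (nakamura_inverse y) \<in> \<Gamma>"
    then have "nakamura_mult x (nakamura_inverse y) = (0,0)" using AB T by fastforce
    then show "x = y"
      by (metis nakamura.inv_solve_right UNIV_I inv_nakamura nakamura_group_simps(1,2) nakamura_mult_one)
  qed (use AB in auto)
qed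

lemma nakamura_proj_inj_nbhd: fixes g obtains V where "open V" "g \<in> V" "inj_on (nakamura_proj \<Gamma>) V"
proof -
  obtain N where N: "open N" "(0,0) \<in> N" "\<And>x y. x \<in> N \<Longrightarrow> y \<in> N \<Longrightarrow> nakamura_mult x (nakamura_inverse y) \<in> \<Gamma> \<Longrightarrow> x = y"
    using nakamura_discrete_nbhd by metis
  let ?V = "(\<lambda>x. nakamura_mult x (nakamura_inverse g)) -` N"
  have "open ?V" by (intro open_vimage N continuous_nakamura_mult continuous_intros)
  moreover have "g \<in> ?V" using N(2) by (metis nakamura.r_inv UNIV_I inv_nakamura nakamura_group_simps vimageI)
  moreover have "inj_on (nakamura_proj \<Gamma>) ?V"
  proof (rule inj_onI)
    fix x y assume xy: "x \<in> ?V" "y \<in> ?V" "nakamura_proj \<Gamma> x = nakamura_proj \<Gamma> y"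
    have "nakamura_mult (nakamura_mult x (nakamura_inverse g)) (nakamura_inverse (nakamura_mult y (nakamura_inverse g))) = nakamura_mult x (nakamura_inverse y)"
      using nakamura.inv_mult_group[of y "nakamura_inverse g"] nakamura.inv_inv[of g]
      by (simp add: nakamura_mult_assoc) (metis nakamura_mult_assoc nakamura_mult_inverse nakamura_mult_one)
    then have "nakamura_mult x (nakamura_inverse g) = nakamura_mult y (nakamura_inverse g)" using N(3) xy by (simp add: nakamura_proj_eq_iff)
    then show "x = y" using nakamura.right_cancel[of "nakamura_inverse g" x y] by simp
  qed
  ultimately show ?thesis by (rule that)
qed

lemma linear_nakamura_coords: "linear nakamura_coords"
  by (rule linearI) (auto simp: nakamura_coords_def vec_eq_iff forall_3 split: prod.splits)

definition nakamura_uncoords :: "3 cvec \<Rightarrow> complex \<times> 2 cvec" where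
  "nakamura_uncoords v = (v $ 1, vector [v $ 2, v $ 3])"

lemma nakamura_uncoords_coords [simp]: "nakamura_uncoords (nakamura_coords g) = g" "nakamura_coords (nakamura_uncoords v) = v"
  by (auto simp: nakamura_uncoords_def nakamura_coords_def vec_eq_iff forall_3 forall_2 split: prod.splits)

lemma nakamura_atlas_cover: "(\<Union>c\<in>nakamura_atlas \<Gamma>. fst c) = range (nakamura_proj \<Gamma>)"
proof (intro equalityI subsetI)
  fix p assume "p \<in> range (nakamura_proj \<Gamma>)"
  then obtain g where g: "p = nakamura_proj \<Gamma> g" by (rule rangeE)
  obtain V where V: "open V" "g \<in> V" "inj_on (nakamura_proj \<Gamma>) V"
    using nakamura_proj_inj_nbhd[of g] by metis
  have "(nakamura_proj \<Gamma> ` V, nakamura_coords \<circ> inv_into V (nakamura_proj \<Gamma>)) \<in> nakamura_atlas \<Gamma>"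
    unfolding nakamura_atlas_def using V(1,3) by blast
  moreover have "p \<in> nakamura_proj \<Gamma> ` V" using V(2) g by (rule image_eqI[rotated])
  ultimately show "p \<in> (\<Union>c\<in>nakamura_atlas \<Gamma>. fst c)"
    by (metis UN_I fst_conv)
qed (auto simp: nakamura_atlas_def)

lemma nakamura_chart_image: "inj_on (nakamura_proj \<Gamma>) V \<Longrightarrow> (nakamura_coords \<circ> inv_into V (nakamura_proj \<Gamma>)) ` (nakamura_proj \<Gamma> ` V) = nakamura_coords ` V"
  by (force simp: image_iff)

lemma nakamura_chart_inverse:
  assumes "inj_on (nakamura_proj \<Gamma>) V" "g \<in> V"
  shows "inv_into (nakamura_proj \<Gamma> ` V) (nakamura_coords \<circ> inv_into V (nakamura_proj \<Gamma>)) (nakamura_coords g) = nakamura_proj \<Gamma> g"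
proof (rule inv_into_f_eq)
  show "inj_on (nakamura_coords \<circ> inv_into V (nakamura_proj \<Gamma>)) (nakamura_proj \<Gamma> ` V)"
    using assms(1) by (intro comp_inj_on inj_on_inv_into) (auto intro!: inj_onI dest: arg_cong[of _ _ nakamura_uncoords])
qed (use assms in auto)

definition nakamura_jacobian :: "complex \<Rightarrow> 3 cmat" where
  "nakamura_jacobian a = (\<chi> i j. if i = j then (if i = 1 then 1 else if i = 2 then exp a else exp (- a)) else 0)"

lemma nakamura_mult_affine: "nakamura_coords (nakamura_mult \<gamma> (nakamura_uncoords y)) = nakamura_coords \<gamma> + nakamura_jacobian (fst \<gamma>) *v y"
  by (auto simp: nakamura_coords_def nakamura_uncoords_def nakamura_mult_def nakamura_jacobian_def vec_eq_iff forall_3 sum_3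
     matrix_vector_mult_def nakamura_phi_def sum_2 split: prod.splits)

lemma nakamura_coords_image: "nakamura_coords ` V = nakamura_uncoords -` V"
  by (auto simp: image_iff) (metis nakamura_uncoords_coords(2))

lemma continuous_nakamura_uncoords: "continuous_on UNIV nakamura_uncoords"
proof -
  have "nakamura_uncoords = (\<lambda>v. (v $ 1, \<chi> i. if i = 1 then v $ 2 else v $ 3))"
    by (auto simp: nakamura_uncoords_def vec_eq_iff forall_2 fun_eq_iff)
  moreover have "continuous_on UNIV (\<lambda>v::3 cvec. (v $ 1, \<chi> i::2. if i = 1 then v $ 2 else v $ 3))"
    apply (intro continuous_intros continuous_on_vec_lambda)
    subgoal for i by (cases "i = 1") (auto intro!: continuous_intros)
    done
  ultimately show ?thesis by (simp only:)
qed

lemma continuous_nakamura_coords: "continuous_on UNIV nakamura_coords"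
  using linear_nakamura_coords linear_continuous_on linear_conv_bounded_linear by blast

lemma open_nakamura_coords: "open V \<Longrightarrow> open (nakamura_coords ` V)"
  unfolding nakamura_coords_image by (intro open_vimage continuous_nakamura_uncoords)

lemma nakamura_transition_derivative:
  assumes V: "open V" "inj_on (nakamura_proj \<Gamma>) V" and W: "open W" "inj_on (nakamura_proj \<Gamma>) W"
    and g: "g \<in> V" "nakamura_proj \<Gamma> g \<in> nakamura_proj \<Gamma> ` W"
  shows "\<exists>\<gamma>\<in>\<Gamma>. nakamura_mult \<gamma> g \<in> W \<and> (transition (nakamura_proj \<Gamma> ` V, nakamura_coords \<circ> inv_into V (nakamura_proj \<Gamma>))
     (nakamura_proj \<Gamma> ` W, nakamura_coords \<circ> inv_into W (nakamura_proj \<Gamma>)) has_derivative (\<lambda>v. nakamura_jacobian (fst \<gamma>) *v v)) (at (nakamura_coords g))"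
proof -
  obtain \<gamma> where \<gamma>: "\<gamma> \<in> \<Gamma>" "nakamura_mult \<gamma> g \<in> W" using g(2) nakamura_proj_eq_iff_ex by (metis imageE)
  let ?S = "nakamura_uncoords -` (V \<inter> (\<lambda>g. nakamura_mult \<gamma> g) -` W)"
  have S: "open ?S" 
    by (intro open_vimage continuous_nakamura_uncoords open_Int V W continuous_nakamura_mult continuous_intros)
  have gS: "nakamura_coords g \<in> ?S" using g \<gamma> by simp
  have aff: "((\<lambda>y. nakamura_coords \<gamma> + nakamura_jacobian (fst \<gamma>) *v y) has_derivative (\<lambda>v. nakamura_jacobian (fst \<gamma>) *v v)) (at (nakamura_coords g))"
    by (auto intro!: derivative_eq_intros bounded_linear.has_derivative[OF matrix_vector_mul_bounded_linear])
  have "(transition (nakamura_proj \<Gamma> ` V, nakamura_coords \<circ> inv_into V (nakamura_proj \<Gamma>))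
     (nakamura_proj \<Gamma> ` W, nakamura_coords \<circ> inv_into W (nakamura_proj \<Gamma>)) has_derivative (\<lambda>v. nakamura_jacobian (fst \<gamma>) *v v)) (at (nakamura_coords g))"
  proof (rule has_derivative_transform_within_open[OF aff S gS])
    fix y assume y: "y \<in> ?S"
    have "inv_into (nakamura_proj \<Gamma> ` V) (nakamura_coords \<circ> inv_into V (nakamura_proj \<Gamma>)) y = nakamura_proj \<Gamma> (nakamura_uncoords y)"
      using nakamura_chart_inverse[OF V(2), of "nakamura_uncoords y"] y by simp
    moreover have "nakamura_proj \<Gamma> (nakamura_uncoords y) = nakamura_proj \<Gamma> (nakamura_mult \<gamma> (nakamura_uncoords y))" using nakamura_proj_eq_iff_ex \<gamma>(1) by metis
    moreover have "inv_into W (nakamura_proj \<Gamma>) (nakamura_proj \<Gamma> (nakamura_mult \<gamma> (nakamura_uncoords y))) = nakamura_mult \<gamma> (nakamura_uncoords y)"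
      using y W by simp
    ultimately show "nakamura_coords \<gamma> + nakamura_jacobian (fst \<gamma>) *v y = transition (nakamura_proj \<Gamma> ` V, nakamura_coords \<circ> inv_into V (nakamura_proj \<Gamma>))
     (nakamura_proj \<Gamma> ` W, nakamura_coords \<circ> inv_into W (nakamura_proj \<Gamma>)) y"
      by (simp add: transition_def nakamura_mult_affine)
  qed
  then show ?thesis using \<gamma> by blast
qed

lemma nakamura_chart_homeomorphic:
  assumes V: "open V" "inj_on (nakamura_proj \<Gamma>) V"
  shows "homeomorphic_map (subtopology (coset_topology nakamura_group \<Gamma>) (nakamura_proj \<Gamma> ` V)) 
     (top_of_set (nakamura_coords ` V)) (nakamura_coords \<circ> inv_into V (nakamura_proj \<Gamma>))"
proof -
  let ?X = "coset_topology nakamura_group \<Gamma>"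
  have pc: "continuous_map euclidean ?X (nakamura_proj \<Gamma>)"
    by (auto simp: continuous_map_def topspace_nakamura_topology openin_nakamura_topology)
  have "homeomorphic_maps (subtopology ?X (nakamura_proj \<Gamma> ` V)) 
     (top_of_set (nakamura_coords ` V)) (nakamura_coords \<circ> inv_into V (nakamura_proj \<Gamma>)) (nakamura_proj \<Gamma> \<circ> nakamura_uncoords)"
    unfolding homeomorphic_maps_def
  proof (intro conjI ballI)
    have "continuous_map (subtopology ?X (nakamura_proj \<Gamma> ` V)) (top_of_set V) (inv_into V (nakamura_proj \<Gamma>))"
      unfolding continuous_map_def
    proof (intro conjI allI impI)
      show "inv_into V (nakamura_proj \<Gamma>) \<in> topspace (subtopology ?X (nakamura_proj \<Gamma> ` V)) \<rightarrow> topspace (top_of_set V)"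
        by (auto simp: topspace_nakamura_topology simp del: split_paired_All intro!: inv_into_into)
      fix U assume U: "openin (top_of_set V) U"
      then have "open U" "U \<subseteq> V" using V(1) by (auto simp: openin_open_eq)
      moreover then have "{x \<in> topspace (subtopology ?X (nakamura_proj \<Gamma> ` V)). inv_into V (nakamura_proj \<Gamma>) x \<in> U} = nakamura_proj \<Gamma> ` U"
        using V(2) by (auto simp: topspace_nakamura_topology)
      ultimately show "openin (subtopology ?X (nakamura_proj \<Gamma> ` V)) {x \<in> topspace (subtopology ?X (nakamura_proj \<Gamma> ` V)). inv_into V (nakamura_proj \<Gamma>) x \<in> U}"
        using openin_nakamura_proj_image[OF V(1)] openin_nakamura_proj_image by (simp add: openin_open_subtopology image_mono)
    qed
    moreover have "continuous_map (top_of_set V) (top_of_set (nakamura_coords ` V)) nakamura_coords"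
      using continuous_nakamura_coords by (auto intro: continuous_on_subset)
    ultimately show "continuous_map (subtopology ?X (nakamura_proj \<Gamma> ` V)) (top_of_set (nakamura_coords ` V)) (nakamura_coords \<circ> inv_into V (nakamura_proj \<Gamma>))"
      by (rule continuous_map_compose)
    show "continuous_map (top_of_set (nakamura_coords ` V)) (subtopology ?X (nakamura_proj \<Gamma> ` V)) (nakamura_proj \<Gamma> \<circ> nakamura_uncoords)"
    proof (rule continuous_map_into_subtopology)
      show "continuous_map (top_of_set (nakamura_coords ` V)) ?X (nakamura_proj \<Gamma> \<circ> nakamura_uncoords)"
        using continuous_map_compose[OF _ pc] continuous_on_subset[OF continuous_nakamura_uncoords]
        by (metis continuous_map_iff_continuous subset_UNIV)
      show "nakamura_proj \<Gamma> \<circ> nakamura_uncoords \<in> topspace (top_of_set (nakamura_coords ` V)) \<rightarrow> nakamura_proj \<Gamma> ` V"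
        by (simp add: nakamura_coords_image)
    qed
  next
    fix p assume "p \<in> topspace (subtopology ?X (nakamura_proj \<Gamma> ` V))"
    then obtain g where "g \<in> V" "p = nakamura_proj \<Gamma> g" by (auto simp: topspace_subtopology)
    then show "(nakamura_proj \<Gamma> \<circ> nakamura_uncoords) ((nakamura_coords \<circ> inv_into V (nakamura_proj \<Gamma>)) p) = p"
      using V(2) by simp
  next
    fix y assume "y \<in> topspace (top_of_set (nakamura_coords ` V))"
    then obtain g where "g \<in> V" "y = nakamura_coords g" by (auto simp only: topspace_euclidean_subtopology)
    then show "(nakamura_coords \<circ> inv_into V (nakamura_proj \<Gamma>)) ((nakamura_proj \<Gamma> \<circ> nakamura_uncoords) y) = y"
      using V(2) by simp
  qed
  then show ?thesis using homeomorphic_maps_map by blast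
qed

lemma closed_nakamura_subgroup: "closed \<Gamma>"
proof -
  obtain N where N: "open N" "(0,0) \<in> N" "\<And>x y. x \<in> N \<Longrightarrow> y \<in> N \<Longrightarrow> nakamura_mult x (nakamura_inverse y) \<in> \<Gamma> \<Longrightarrow> x = y"
    using nakamura_discrete_nbhd by metis
  have "p \<in> \<Gamma>" if lim: "p islimpt \<Gamma>" for p
  proof -
    let ?T = "(\<lambda>x. nakamura_mult x (nakamura_inverse p)) -` N"
    have T: "open ?T" by (intro open_vimage N continuous_nakamura_mult continuous_intros)
    have pT: "p \<in> ?T" using N(2) by (metis nakamura.r_inv UNIV_I inv_nakamura nakamura_group_simps vimageI)
    have uniq: "x = y" if "x \<in> ?T" "y \<in> ?T" "x \<in> \<Gamma>" "y \<in> \<Gamma>" for x y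
    proof -
      have "nakamura_mult (nakamura_mult x (nakamura_inverse p)) (nakamura_inverse (nakamura_mult y (nakamura_inverse p))) = nakamura_mult x (nakamura_inverse y)"
        using nakamura.inv_mult_group[of y "nakamura_inverse p"] nakamura.inv_inv[of p]
        by (simp add: nakamura_mult_assoc) (metis nakamura_mult_assoc nakamura_mult_inverse nakamura_mult_one)
      moreover have "nakamura_mult x (nakamura_inverse y) \<in> \<Gamma>"
        using subgroup.m_closed[OF sub that(3)] subgroup.m_inv_closed[OF sub that(4)] by simp
      ultimately have "nakamura_mult x (nakamura_inverse p) = nakamura_mult y (nakamura_inverse p)" using N(3) that by simp
      then show "x = y" using nakamura.right_cancel[of "nakamura_inverse p" x y] by simp
    qed
    obtain y where y: "y \<in> \<Gamma>" "y \<in> ?T" "y \<noteq> p" using lim T pT unfolding islimpt_def by (metis (no_types, lifting))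
    have "open (?T - {y})" "p \<in> ?T - {y}" using T pT y by auto
    then obtain y' where "y' \<in> \<Gamma>" "y' \<in> ?T - {y}" using lim unfolding islimpt_def by (metis (no_types, lifting))
    then show ?thesis using uniq y by blast
  qed
  then show ?thesis by (simp add: closed_limpt)
qed

lemma Hausdorff_nakamura: "Hausdorff_space (coset_topology nakamura_group \<Gamma>)"
  unfolding Hausdorff_space_def topspace_nakamura_topology
proof (intro allI impI, elim conjE)
  fix p q assume "p \<in> range (nakamura_proj \<Gamma>)" "q \<in> range (nakamura_proj \<Gamma>)" "p \<noteq> q"
  then obtain x y where xy: "p = nakamura_proj \<Gamma> x" "q = nakamura_proj \<Gamma> y" "nakamura_proj \<Gamma> x \<noteq> nakamura_proj \<Gamma> y" by blast
  let ?f = "\<lambda>p. nakamura_mult (fst p) (nakamura_inverse (snd p))"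
  have "open (?f -` (- \<Gamma>))"
    by (intro open_vimage open_Compl closed_nakamura_subgroup continuous_nakamura_mult continuous_nakamura_inverse continuous_intros)
  moreover have "(x, y) \<in> ?f -` (- \<Gamma>)" using xy by (simp add: nakamura_proj_eq_iff)
  ultimately obtain A B where AB: "open A" "open B" "(x,y) \<in> A \<times> B" "A \<times> B \<subseteq> ?f -` (- \<Gamma>)"
    by (rule open_prod_elim)
  have "disjnt (nakamura_proj \<Gamma> ` A) (nakamura_proj \<Gamma> ` B)"
    using AB(4) by (fastforce simp: disjnt_iff nakamura_proj_eq_iff)
  then show "\<exists>U V. openin (coset_topology nakamura_group \<Gamma>) U \<and> openin (coset_topology nakamura_group \<Gamma>) V \<and> p \<in> U \<and> q \<in> V \<and> disjnt U V"
    using AB(1-3) openin_nakamura_proj_image xy(1,2)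
    by (intro exI[of _ "nakamura_proj \<Gamma> ` A"] exI[of _ "nakamura_proj \<Gamma> ` B"]) auto
qed

lemma second_countable_nakamura: "\<exists>\<B>. countable \<B> \<and> (\<forall>B\<in>\<B>. openin (coset_topology nakamura_group \<Gamma>) B) \<and>
        (\<forall>U. openin (coset_topology nakamura_group \<Gamma>) U \<longrightarrow> (\<exists>\<C>\<subseteq>\<B>. U = \<Union>\<C>))"
proof -
  obtain B :: "(complex \<times> 2 cvec) set set" where B: "countable B" "topological_basis B"
    using ex_countable_basis by blast
  show ?thesis
  proof (rule exI[of _ "(`) (nakamura_proj \<Gamma>) ` B"], intro conjI allI impI ballI)
    fix U assume U: "openin (coset_topology nakamura_group \<Gamma>) U"
    then obtain C where C: "C \<subseteq> B" "\<Union>C = {g. nakamura_proj \<Gamma> g \<in> U}"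
      using B(2) unfolding openin_nakamura_topology topological_basis_def by metis
    have "U = nakamura_proj \<Gamma> ` {g. nakamura_proj \<Gamma> g \<in> U}" using U by (auto simp: openin_nakamura_topology)
    then have "U = \<Union>((`) (nakamura_proj \<Gamma>) ` C)" unfolding C(2)[symmetric] image_Union by (simp only:)
    then show "\<exists>\<C>\<subseteq>(`) (nakamura_proj \<Gamma>) ` B. U = \<Union>\<C>"
      using image_mono[OF C(1)] by (intro exI[of _ "(`) (nakamura_proj \<Gamma>) ` C"] conjI)
  next
    fix b assume "b \<in> (`) (nakamura_proj \<Gamma>) ` B"
    then show "openin (coset_topology nakamura_group \<Gamma>) b"
      using openin_nakamura_proj_image topological_basis_open[OF B(2)] by auto
  qed (simp add: B)
qed

lemma complex_manifold_nakamura: "complex_manifold (coset_topology nakamura_group \<Gamma>) (nakamura_atlas \<Gamma>)"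
  unfolding complex_manifold_def
proof (intro conjI ballI Hausdorff_nakamura second_countable_nakamura)
  show "topspace (coset_topology nakamura_group \<Gamma>) = (\<Union>c\<in>nakamura_atlas \<Gamma>. fst c)"
    by (simp add: topspace_nakamura_topology nakamura_atlas_cover)
next
  fix c assume "c \<in> nakamura_atlas \<Gamma>"
  then obtain V where V: "c = (nakamura_proj \<Gamma> ` V, nakamura_coords \<circ> inv_into V (nakamura_proj \<Gamma>))" "open V" "inj_on (nakamura_proj \<Gamma>) V"
    by (auto simp: nakamura_atlas_def)
  show "openin (coset_topology nakamura_group \<Gamma>) (fst c)" using V openin_nakamura_proj_image by simp
  show "open (snd c ` fst c)" unfolding V(1) fst_conv snd_conv nakamura_chart_image[OF V(3)] by (rule open_nakamura_coords[OF V(2)])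
  show "homeomorphic_map (subtopology (coset_topology nakamura_group \<Gamma>) (fst c)) (top_of_set (snd c ` fst c)) (snd c)"
    unfolding V(1) fst_conv snd_conv nakamura_chart_image[OF V(3)] by (rule nakamura_chart_homeomorphic[OF V(2,3)])
next
  fix c c' x assume c: "c \<in> nakamura_atlas \<Gamma>" "c' \<in> nakamura_atlas \<Gamma>" and x: "x \<in> snd c ` (fst c \<inter> fst c')"
  obtain V where V: "c = (nakamura_proj \<Gamma> ` V, nakamura_coords \<circ> inv_into V (nakamura_proj \<Gamma>))" "open V" "inj_on (nakamura_proj \<Gamma>) V"
    using c by (auto simp: nakamura_atlas_def)
  obtain W where W: "c' = (nakamura_proj \<Gamma> ` W, nakamura_coords \<circ> inv_into W (nakamura_proj \<Gamma>))" "open W" "inj_on (nakamura_proj \<Gamma>) W"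
    using c by (auto simp: nakamura_atlas_def)
  obtain p where p: "p \<in> fst c" "p \<in> fst c'" "x = snd c p" using x by blast
  then obtain g where g: "g \<in> V" "p = nakamura_proj \<Gamma> g" using V(1) by auto
  then have x': "x = nakamura_coords g" and gW: "nakamura_proj \<Gamma> g \<in> nakamura_proj \<Gamma> ` W"
    using V(1,3) W(1) p by simp_all
  have "\<exists>\<gamma>\<in>\<Gamma>. nakamura_mult \<gamma> g \<in> W \<and>
      (transition c c' has_derivative (\<lambda>v. nakamura_jacobian (fst \<gamma>) *v v)) (at x)"
    unfolding V(1) W(1) x' by (rule nakamura_transition_derivative[OF V(2,3) W(2,3) g(1) gW])
  then obtain \<gamma> where "\<gamma> \<in> \<Gamma>" and \<gamma>: "nakamura_mult \<gamma> g \<in> W \<and>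
      (transition c c' has_derivative (\<lambda>v. nakamura_jacobian (fst \<gamma>) *v v)) (at x)"
    by (rule bexE)
  show "\<exists>J. (transition c c' has_derivative (\<lambda>v. J *v v)) (at x)"
    by (intro exI, rule conjunct2[OF \<gamma>])
qed

definition invariant_metric :: "3 cvec \<Rightarrow> 3 cmat" where
  "invariant_metric y = (\<chi> i j. if i = j then
     (if i = 1 then 1 else of_real (if i = 2 then exp (- 2 * Re (y $ 1)) else exp (2 * Re (y $ 1)))) else 0)"

lemma C_k_on_exp_Re: "C_k_on k (\<lambda>y::3 cvec. A + exp (- 2 * Re (y $ 1)) *\<^sub>R B + exp (2 * Re (y $ 1)) *\<^sub>R C) S" for A B C :: "3 cmat"
proof (induction k arbitrary: A B C)
  case 0
  show ?case by (auto intro!: continuous_intros)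
next
  case (Suc k)
  let ?f = "\<lambda>y::3 cvec. A + exp (- 2 * Re (y $ 1)) *\<^sub>R B + exp (2 * Re (y $ 1)) *\<^sub>R C"
  have d: "(?f has_derivative (\<lambda>v. (0::3 cmat) + exp (- 2 * Re (y $ 1)) *\<^sub>R ((- 2 * Re (v $ 1)) *\<^sub>R B) + exp (2 * Re (y $ 1)) *\<^sub>R ((2 * Re (v $ 1)) *\<^sub>R C))) (at y)" for y
    by (auto intro!: derivative_eq_intros bounded_linear.has_derivative[OF bounded_linear_vec_nth] simp: algebra_simps fun_eq_iff)
  show ?case
    unfolding C_k_on.simps frechet_derivative_at[OF d, symmetric]
    by (intro conjI ballI allI Suc.IH differentiableI[OF d])
qed

lemma smooth_on_invariant_metric: "smooth_on invariant_metric S"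
proof -
  let ?E = "\<lambda>k. (\<chi> i j. if i = j \<and> i = k then 1 else 0) :: 3 cmat"
  have eq: "invariant_metric = (\<lambda>y. ?E 1 + exp (- 2 * Re (y $ 1)) *\<^sub>R ?E 2 + exp (2 * Re (y $ 1)) *\<^sub>R ?E 3)"
    by (auto simp: fun_eq_iff invariant_metric_def vec_eq_iff forall_3 of_real_def)
  show ?thesis
    unfolding smooth_on_def eq by (intro allI C_k_on_exp_Re)
qed

lemma hermitian_posdef_invariant_metric: "hermitian_posdef (invariant_metric y)"
proof -
  have pos: "0 < (cmod (v $ 1))\<^sup>2 + exp (- 2 * Re (y $ 1)) * (cmod (v $ 2))\<^sup>2 + exp (2 * Re (y $ 1)) * (cmod (v $ 3))\<^sup>2" if "v \<noteq> 0" for v :: "3 cvec"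
    using that by (auto simp: vec_eq_iff forall_3 add_pos_nonneg add_nonneg_pos)
  have Re_sum: "Re (\<Sum>j\<in>UNIV. \<Sum>k\<in>UNIV. invariant_metric y $ j $ k * v $ j * cnj (v $ k)) = (cmod (v $ 1))\<^sup>2 + exp (- 2 * Re (y $ 1)) * (cmod (v $ 2))\<^sup>2 + exp (2 * Re (y $ 1)) * (cmod (v $ 3))\<^sup>2" for v :: "3 cvec"
    unfolding cmod_power2 by (simp add: invariant_metric_def sum_3 algebra_simps power2_eq_square)
  have sym: "invariant_metric y $ k $ j = cnj (invariant_metric y $ j $ k)" for j k
    by (simp add: invariant_metric_def)
  show ?thesis
    unfolding hermitian_posdef_def Re_sum by (intro conjI allI impI sym pos)
qed

lemma invariant_metric_transform: "invariant_metric y = transpose (nakamura_jacobian a) ** invariant_metric (u + nakamura_jacobian a *v y) ** (\<chi> j k. cnj (nakamura_jacobian a $ j $ k))" if "u $ 1 = a"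
proof -
  have 1: "exp a * cnj (exp a) = complex_of_real (exp (2 * Re a))" for a
    by (metis complex_norm_square exp_double norm_exp_eq_Re)
  have 2: "exp b * complex_of_real r * cnj (exp b) = of_real (exp (2 * Re b) * r)" for b r
    using 1[of b] by (metis mult.assoc mult.commute of_real_mult)
  have "complex_of_real (exp (- 2 * Re (y $ 1))) = exp a * complex_of_real (exp (- 2 * Re (a + y $ 1))) * cnj (exp a)"
    unfolding 2 exp_add[symmetric] by (simp add: algebra_simps)
  moreover have "complex_of_real (exp (2 * Re (y $ 1))) = exp (-a) * complex_of_real (exp (2 * Re (a + y $ 1))) * cnj (exp (-a))"
    unfolding 2 exp_add[symmetric] by (simp add: algebra_simps)
  ultimately show ?thesis using that
    by (simp add: vec_eq_iff forall_3 invariant_metric_def nakamura_jacobian_def transpose_def matrix_matrix_mult_def sum_3 matrix_vector_mult_def)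
qed

lemma hermitian_metric_invariant_metric: "hermitian_metric (nakamura_atlas \<Gamma>) (\<lambda>_. invariant_metric)"
  unfolding hermitian_metric_def
proof (intro conjI ballI smooth_on_invariant_metric hermitian_posdef_invariant_metric)
  fix c c' p assume c: "c \<in> nakamura_atlas \<Gamma>" "c' \<in> nakamura_atlas \<Gamma>" and p: "p \<in> fst c \<inter> fst c'"
  obtain V where V: "c = (nakamura_proj \<Gamma> ` V, nakamura_coords \<circ> inv_into V (nakamura_proj \<Gamma>))" "open V" "inj_on (nakamura_proj \<Gamma>) V"
    using c by (auto simp: nakamura_atlas_def)
  obtain W where W: "c' = (nakamura_proj \<Gamma> ` W, nakamura_coords \<circ> inv_into W (nakamura_proj \<Gamma>))" "open W" "inj_on (nakamura_proj \<Gamma>) W"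
    using c by (auto simp: nakamura_atlas_def)
  obtain g where g: "g \<in> V" "nakamura_proj \<Gamma> g \<in> nakamura_proj \<Gamma> ` W" "p = nakamura_proj \<Gamma> g"
    using p V(1) W(1) by auto
  have x: "snd c p = nakamura_coords g" using g V by simp
  have "\<exists>\<gamma>\<in>\<Gamma>. nakamura_mult \<gamma> g \<in> W \<and>
      (transition c c' has_derivative (\<lambda>v. nakamura_jacobian (fst \<gamma>) *v v)) (at (nakamura_coords g))"
    unfolding V(1) W(1) by (rule nakamura_transition_derivative[OF V(2,3) W(2,3) g(1,2)])
  then obtain \<gamma> where \<gamma>1: "\<gamma> \<in> \<Gamma>" and \<gamma>2: "nakamura_mult \<gamma> g \<in> W \<and>
      (transition c c' has_derivative (\<lambda>v. nakamura_jacobian (fst \<gamma>) *v v)) (at (nakamura_coords g))"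
    by (rule bexE)
  note \<gamma> = \<gamma>1 conjunct1[OF \<gamma>2] conjunct2[OF \<gamma>2]
  have J: "jacobian (transition c c') (at (snd c p)) = nakamura_jacobian (fst \<gamma>)"
    unfolding jacobian_def x frechet_derivative_at[OF \<gamma>(3), symmetric] by simp
  have "p = nakamura_proj \<Gamma> (nakamura_mult \<gamma> g)" using nakamura_proj_eq_iff_ex g(3) \<gamma>(1) by metis
  then have "snd c' p = nakamura_coords (nakamura_mult \<gamma> g)" using W \<gamma>(2) by simp
  then have 2: "snd c' p = nakamura_coords \<gamma> + nakamura_jacobian (fst \<gamma>) *v nakamura_coords g"
    using nakamura_mult_affine[of \<gamma> "nakamura_coords g"] by simp
  have "nakamura_coords \<gamma> $ 1 = fst \<gamma>" by (simp add: nakamura_coords_def split: prod.splits)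
  from invariant_metric_transform[OF this] show "let J = jacobian (transition c c') (at (snd c p))
        in invariant_metric (snd c p) = transpose J ** invariant_metric (snd c' p) ** (\<chi> j k. cnj (J $ j $ k))"
    unfolding Let_def 2 x J[unfolded x] .
qed

end

end

theory Submission
  imports Defs "HOL-Complex_Analysis.Cauchy_Integral_Formula"
begin

text \<open>In dimension three the condition reads \<open>\<partial>\<close>$\bar\partial$\<open>\<omega> = 0\<close>. Lift the metric to a \<open>\<Gamma>\<close>-invariant one
  on \<open>G = \<complex>\<^sup>3\<close>, and look at the coefficient of
  \<open>dz \<and> dw\<^sub>2 \<and> d\<close>$\bar z$\<open> \<and> d\<close>$\bar w_2$. All its terms except $\partial_z\partial_{\bar z} h_{33}$
  are derivatives in the direction of \<open>w\<^sub>2\<close>, so they vanish after averaging over \<open>\<complex>\<^sup>2/\<Gamma>''\<close>. The mean of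
  $h_{33}$ over the fibre is therefore a positive harmonic function of \<open>z \<in> \<complex>\<close>, hence constant by
  Liouville's theorem. But invariance makes this mean at \<open>z\<close> at most $C e^{2\,\mathrm{Re}\, z}$ for \<open>z\<close> in
  the lattice of \<open>\<complex>\<close>, which tends to \<open>0\<close> along a suitable sequence of lattice points.\<close>

section \<open>Smooth functions and averages over segments\<close>

lemma frechet_derivative_cong_open:
  assumes "open S" "x \<in> S" "\<And>y. y \<in> S \<Longrightarrow> f y = g y"
  shows "frechet_derivative f (at x) = frechet_derivative g (at x)"
proof -
  have "(f has_derivative f') (at x) \<longleftrightarrow> (g has_derivative f') (at x)" for f'
    using has_derivative_transform_within_open[OF _ assms(1,2)] assms(3) by metis
  then show ?thesis
    by (simp add: frechet_derivative_def)
qed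

text \<open>The local representatives \<open>g x\<close> are generalized in the induction: their
  directional derivatives represent those of \<open>f\<close> near \<open>x\<close>. This is what
  glues the matrices of a metric in different charts into one smooth map.\<close>

lemma C_k_on_local:
  assumes "\<And>x. x \<in> S \<Longrightarrow> \<exists>T. open T \<and> x \<in> T \<and> C_k_on k (g x) T \<and> (\<forall>y\<in>T. f y = g x y)"
  shows "C_k_on k f S"
  using assms
proof (induction k arbitrary: f g)
  case 0
  have "continuous (at x) f" if x: "x \<in> S" for x
  proof -
    obtain T where T: "open T" "x \<in> T" "continuous_on T (g x)" "\<forall>y\<in>T. f y = g x y"
      using 0[OF x] by auto
    then have "continuous_on T f"
      by (metis continuous_on_eq)
    with T(1,2) show ?thesis
      by (simp add: continuous_on_eq_continuous_at)
  qed
  then show ?case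
    by (simp add: continuous_at_imp_continuous_on)
next
  case (Suc k)
  have d: "f differentiable (at x)" if x: "x \<in> S" for x
  proof -
    obtain T where T: "open T" "x \<in> T" "g x differentiable (at x)" "\<forall>y\<in>T. f y = g x y"
      using Suc.prems[OF x] by auto
    then show ?thesis
      unfolding differentiable_def
      using has_derivative_transform_within_open[OF _ T(1,2), of "g x" _ UNIV f] by auto
  qed
  have "C_k_on k (\<lambda>x. frechet_derivative f (at x) v) S" for v
  proof (rule Suc.IH)
    fix x assume x: "x \<in> S"
    obtain T where T: "open T" "x \<in> T" "C_k_on (Suc k) (g x) T" "\<forall>y\<in>T. f y = g x y"
      using Suc.prems[OF x] by blast
    then have "frechet_derivative f (at y) v = frechet_derivative (g x) (at y) v" if "y \<in> T" for y
      using frechet_derivative_cong_open[OF T(1) that, of f "g x"] by simp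
    with T show "\<exists>T. open T \<and> x \<in> T \<and> C_k_on k (\<lambda>y. frechet_derivative (g x) (at y) v) T \<and>
        (\<forall>y\<in>T. frechet_derivative f (at y) v = frechet_derivative (g x) (at y) v)"
      by auto
  qed
  with d show ?case
    by simp
qed

lemma frechet_derivative_bounded_linear:
  assumes "bounded_linear F" "f differentiable (at x)"
  shows "frechet_derivative (\<lambda>x. F (f x)) (at x) = (\<lambda>v. F (frechet_derivative f (at x) v))"
  using bounded_linear.has_derivative[OF assms(1)] assms(2) frechet_derivative_at
    frechet_derivative_works by metis

lemma C_k_on_bounded_linear:
  "bounded_linear F \<Longrightarrow> C_k_on k f UNIV \<Longrightarrow> C_k_on k (\<lambda>x. F (f x)) UNIV"
proof (induction k arbitrary: f)
  case 0
  then show ?case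
    by (simp add: bounded_linear.continuous_on)
next
  case (Suc k)
  have d: "(\<lambda>x. F (f x)) differentiable (at x)" for x
    using Suc.prems bounded_linear.has_derivative[OF Suc.prems(1)]
    by (auto simp: differentiable_def) blast
  show ?case
    using Suc d by (simp add: frechet_derivative_bounded_linear)
qed

lemma frechet_derivative_add:
  assumes "f differentiable (at x)" "g differentiable (at x)"
  shows "frechet_derivative (\<lambda>x. f x + g x) (at x) =
    (\<lambda>v. frechet_derivative f (at x) v + frechet_derivative g (at x) v)"
  using assms by (intro frechet_derivative_at[symmetric] has_derivative_add)
    (simp_all flip: frechet_derivative_works)

lemma C_k_on_add:
  "C_k_on k f UNIV \<Longrightarrow> C_k_on k g UNIV \<Longrightarrow> C_k_on k (\<lambda>x. f x + g x) UNIV"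
proof (induction k arbitrary: f g)
  case 0
  then show ?case
    by (simp add: continuous_on_add)
next
  case (Suc k)
  then show ?case
    by (simp add: frechet_derivative_add)
qed

lemma smooth_on_imp_differentiable: "smooth_on f S \<Longrightarrow> x \<in> S \<Longrightarrow> f differentiable (at x)"
  unfolding smooth_on_def by (metis C_k_on.simps(2))

lemma smooth_on_imp_continuous_on: "smooth_on f S \<Longrightarrow> continuous_on S f"
  unfolding smooth_on_def by (metis C_k_on.simps(1))

lemma smooth_on_frechet_derivative:
  "smooth_on f S \<Longrightarrow> smooth_on (\<lambda>x. frechet_derivative f (at x) v) S"
  unfolding smooth_on_def by (metis C_k_on.simps(2))

lemma smooth_on_bounded_linear:
  "bounded_linear F \<Longrightarrow> smooth_on f UNIV \<Longrightarrow> smooth_on (\<lambda>x. F (f x)) UNIV"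
  by (simp add: smooth_on_def C_k_on_bounded_linear)

lemma smooth_on_add: "smooth_on f UNIV \<Longrightarrow> smooth_on g UNIV \<Longrightarrow> smooth_on (\<lambda>x. f x + g x) UNIV"
  by (simp add: smooth_on_def C_k_on_add)

lemma smooth_on_local:
  assumes "\<And>x. x \<in> S \<Longrightarrow> \<exists>T. open T \<and> x \<in> T \<and> smooth_on (g x) T \<and> (\<forall>y\<in>T. f y = g x y)"
  shows "smooth_on f S"
  unfolding smooth_on_def using assms by (intro allI C_k_on_local[of S _ g]) (meson smooth_on_def)

lemma smooth_on_has_derivative:
  "smooth_on f UNIV \<Longrightarrow> (f has_derivative frechet_derivative f (at x)) (at x)"
  using smooth_on_imp_differentiable frechet_derivative_works by blast

lemma smooth_on_matrix_entry:
  fixes H :: "'a::real_normed_vector \<Rightarrow> 'b::real_normed_vector^'m::finite^'n::finite"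
  shows "smooth_on H UNIV \<Longrightarrow> smooth_on (\<lambda>x. H x $ i $ k) UNIV"
  by (rule smooth_on_bounded_linear[OF bounded_linear_compose[OF bounded_linear_vec_nth
        bounded_linear_vec_nth]])

section \<open>Averages over one segment\<close>

text \<open>For \<open>f\<close> of period \<open>b\<close> this is the mean over the circle
  obtained from the line through \<open>x\<close> in direction \<open>b\<close> modulo
  \<open>b\<close>. The base point stays a variable, so that the mean is again a function on the
  whole space and can be differentiated or averaged once more.\<close>

definition segment_mean ::
  "'a::real_normed_vector \<Rightarrow> ('a \<Rightarrow> 'b::banach) \<Rightarrow> 'a \<Rightarrow> 'b" where
  "segment_mean b f x = integral {0..1} (\<lambda>t::real. f (x + t *\<^sub>R b))"

lemma integrable_segment:
  fixes f :: "'a::real_normed_vector \<Rightarrow> 'b::banach"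
  assumes "continuous_on UNIV f"
  shows "(\<lambda>t::real. f (x + t *\<^sub>R b)) integrable_on {0..1}"
  by (intro integrable_continuous_interval continuous_on_compose2[OF assms] continuous_intros) auto

text \<open>Differentiation under the integral sign.\<close>

lemma segment_mean_has_derivative:
  fixes f :: "'a::euclidean_space \<Rightarrow> 'b::banach"
  assumes "smooth_on f UNIV"
  shows "(segment_mean b f has_derivative
    (\<lambda>v. segment_mean b (\<lambda>y. frechet_derivative f (at y) v) x)) (at x)"
proof -
  \<comment> \<open>The Leibniz rule asks for the derivative as a continuous map into the bounded
    linear operators, so it is packaged as one.\<close>
  define D where "D y = Blinfun (frechet_derivative f (at y))" for y
  have D: "blinfun_apply (D y) = frechet_derivative f (at y)" for y
    using smooth_on_has_derivative[OF assms, of y] unfolding D_def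
    by (simp add: bounded_linear_Blinfun_apply has_derivative_bounded_linear)
  \<comment> \<open>In finite dimension, continuity of \<open>D y v\<close> in \<open>y\<close> for
    each fixed \<open>v\<close> already gives continuity in operator norm.\<close>
  have D_cont: "continuous_on UNIV D"
    by (rule continuous_on_blinfun_componentwise)
      (simp add: D smooth_on_imp_continuous_on smooth_on_frechet_derivative assms)
  have f_cont: "continuous_on UNIV f"
    using assms by (rule smooth_on_imp_continuous_on)
  have "((\<lambda>x. f (x + t *\<^sub>R b)) has_derivative blinfun_apply (D (x + t *\<^sub>R b))) (at x)" for x t
    unfolding D
    by (rule has_derivative_compose[OF _ smooth_on_has_derivative[OF assms]])
      (auto intro!: derivative_eq_intros)
  then have "((\<lambda>x. integral (cbox 0 1) (\<lambda>t::real. f (x + t *\<^sub>R b))) has_derivative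
      blinfun_apply (integral (cbox 0 1) (\<lambda>t::real. D (x + t *\<^sub>R b)))) (at x within UNIV)"
    using integrable_segment[OF f_cont]
    by (intro leibniz_rule)
      (auto simp: split_beta intro!: continuous_intros continuous_on_compose2[OF D_cont])
  moreover have "blinfun_apply (integral (cbox 0 1) (\<lambda>t::real. D (x + t *\<^sub>R b))) =
      (\<lambda>v. segment_mean b (\<lambda>y. frechet_derivative f (at y) v) x)"
    using integrable_segment[OF D_cont, of x b]
    by (auto simp: fun_eq_iff segment_mean_def D integral_linear[unfolded o_def]
      simp flip: D integral_linear[OF _ bounded_linear_apply_blinfun, unfolded o_def])
  ultimately show ?thesis
    by (simp add: segment_mean_def[abs_def])
qed


lemma frechet_derivative_segment_mean:
  fixes f :: "'a::euclidean_space \<Rightarrow> 'b::banach"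
  assumes "smooth_on f UNIV"
  shows "frechet_derivative (segment_mean b f) (at x) v =
    segment_mean b (\<lambda>y. frechet_derivative f (at y) v) x"
  using frechet_derivative_at[OF segment_mean_has_derivative[OF assms]] by metis

lemma smooth_on_segment_mean:
  fixes f :: "'a::euclidean_space \<Rightarrow> 'b::banach"
  assumes "smooth_on f UNIV"
  shows "smooth_on (segment_mean b f) UNIV"
proof -
  have "C_k_on k (segment_mean b f) UNIV" for k
    using assms
  proof (induction k arbitrary: f)
    case 0
    then show ?case
      using has_derivative_continuous[OF segment_mean_has_derivative]
      by (auto intro!: continuous_at_imp_continuous_on)
  next
    case (Suc k)
    then show ?case
      using segment_mean_has_derivative[OF Suc.prems]
      by (auto simp: frechet_derivative_segment_mean smooth_on_frechet_derivative
          intro: differentiableI)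
  qed
  then show ?thesis
    by (simp add: smooth_on_def)
qed

lemma segment_mean_bounded_linear:
  assumes "bounded_linear F" "continuous_on UNIV f"
  shows "segment_mean b (\<lambda>x. F (f x)) = (\<lambda>x. F (segment_mean b f x))"
  using integral_linear[OF integrable_segment[OF assms(2)] assms(1)]
  by (simp add: segment_mean_def o_def fun_eq_iff)

lemma segment_mean_add:
  assumes "continuous_on UNIV f" "continuous_on UNIV g"
  shows "segment_mean b (\<lambda>x. f x + g x) = (\<lambda>x. segment_mean b f x + segment_mean b g x)"
  by (simp add: fun_eq_iff segment_mean_def integral_add integrable_segment assms)

lemma segment_mean_periodic:
  assumes "\<And>x. f (x + w) = f x"
  shows "segment_mean b f (x + w) = segment_mean b f x"
  using assms[of "x + _ *\<^sub>R b"] by (simp add: segment_mean_def algebra_simps)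

text \<open>By the fundamental theorem of calculus the mean is the difference of \<open>f\<close> at
  the two ends of the segment, which differ by the period \<open>b\<close>.\<close>

lemma segment_mean_derivative_period:
  fixes f :: "'a::euclidean_space \<Rightarrow> 'b::banach"
  assumes "smooth_on f UNIV" "\<And>x. f (x + b) = f x"
  shows "segment_mean b (\<lambda>y. frechet_derivative f (at y) b) x = 0"
proof -
  have "((\<lambda>t::real. f (x + t *\<^sub>R b)) has_vector_derivative
      frechet_derivative f (at (x + t *\<^sub>R b)) b) (at t within {0..1})" for t
  proof -
    have "((\<lambda>t::real. f (x + t *\<^sub>R b)) has_derivative
        (\<lambda>h. frechet_derivative f (at (x + t *\<^sub>R b)) (h *\<^sub>R b))) (at t within {0..1})"
      by (rule has_derivative_compose[OF _ smooth_on_has_derivative[OF assms(1)]])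
        (auto intro!: derivative_eq_intros)
    then show ?thesis
      using linear_frechet_derivative[OF smooth_on_imp_differentiable[OF assms(1) UNIV_I]]
      by (simp add: has_vector_derivative_def linear_cmul)
  qed
  then have "((\<lambda>t::real. frechet_derivative f (at (x + t *\<^sub>R b)) b) has_integral
      f (x + 1 *\<^sub>R b) - f (x + 0 *\<^sub>R b)) {0..1}"
    by (intro fundamental_theorem_of_calculus) auto
  then show ?thesis
    by (simp add: segment_mean_def assms(2) integral_unique)
qed

lemma segment_mean_upper_bound:
  fixes f :: "'a::real_normed_vector \<Rightarrow> real"
  assumes "continuous_on UNIV f" "\<And>t. f (x + t *\<^sub>R b) \<le> C"
  shows "segment_mean b f x \<le> C"
  using integral_le[OF integrable_segment[OF assms(1)] integrable_const_ivl, of x b C] assms(2)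
  by (simp add: segment_mean_def)

text \<open>The inequality stays strict because a nonnegative continuous function with zero integral
  vanishes identically on the segment.\<close>

lemma segment_mean_pos:
  fixes f :: "'a::real_normed_vector \<Rightarrow> real"
  assumes "continuous_on UNIV f" "\<And>x. 0 < f x"
  shows "0 < segment_mean b f x"
proof -
  have "continuous_on {0..1} (\<lambda>t. f (x + t *\<^sub>R b))"
    by (intro continuous_on_compose2[OF assms(1)] continuous_intros) auto
  moreover have "0 \<le> f (x + t *\<^sub>R b)" "f (x + t *\<^sub>R b) \<noteq> 0" for t
    using assms(2)[of "x + t *\<^sub>R b"] by simp_all
  ultimately have "segment_mean b f x \<noteq> 0" "0 \<le> segment_mean b f x"
    by (auto simp: segment_mean_def integral_eq_0_iff intro!: integral_nonneg integrable_segment assms)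
  then show ?thesis
    by simp
qed

section \<open>Averages over several directions in turn\<close>

text \<open>If \<open>bs\<close> lists a lattice basis and \<open>f\<close> is periodic under it,
  this is the mean over the torus, written as iterated one-dimensional integrals so that every
  property follows by induction from the one for a segment.\<close>

primrec iterated_mean ::
  "'a::real_normed_vector list \<Rightarrow> ('a \<Rightarrow> 'b::banach) \<Rightarrow> 'a \<Rightarrow> 'b" where
  "iterated_mean [] f = f"
| "iterated_mean (b # bs) f = segment_mean b (iterated_mean bs f)"

lemma smooth_on_iterated_mean:
  fixes f :: "'a::euclidean_space \<Rightarrow> 'b::banach"
  shows "smooth_on f UNIV \<Longrightarrow> smooth_on (iterated_mean bs f) UNIV"
  by (induction bs) (simp_all add: smooth_on_segment_mean)

lemma frechet_derivative_iterated_mean: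
  fixes f :: "'a::euclidean_space \<Rightarrow> 'b::banach"
  assumes "smooth_on f UNIV"
  shows "frechet_derivative (iterated_mean bs f) (at x) v =
    iterated_mean bs (\<lambda>y. frechet_derivative f (at y) v) x"
  by (induction bs arbitrary: x)
    (simp_all add: frechet_derivative_segment_mean smooth_on_iterated_mean assms)

lemma iterated_mean_bounded_linear:
  fixes f :: "'a::euclidean_space \<Rightarrow> 'b::banach"
  assumes "bounded_linear F" "smooth_on f UNIV"
  shows "iterated_mean bs (\<lambda>x. F (f x)) = (\<lambda>x. F (iterated_mean bs f x))"
  by (induction bs)
    (simp_all add: segment_mean_bounded_linear[OF assms(1)] smooth_on_imp_continuous_on
      smooth_on_iterated_mean assms(2))

lemma iterated_mean_add:
  fixes f g :: "'a::euclidean_space \<Rightarrow> 'b::banach"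
  assumes "smooth_on f UNIV" "smooth_on g UNIV"
  shows "iterated_mean bs (\<lambda>x. f x + g x) = (\<lambda>x. iterated_mean bs f x + iterated_mean bs g x)"
  by (induction bs)
    (simp_all add: segment_mean_add smooth_on_imp_continuous_on smooth_on_iterated_mean assms)

lemma iterated_mean_zero: "iterated_mean bs (\<lambda>x. 0) = (\<lambda>x. 0)"
  by (induction bs) (simp_all add: segment_mean_def fun_eq_iff)

lemma iterated_mean_periodic:
  "(\<And>x. f (x + w) = f x) \<Longrightarrow> iterated_mean bs f (x + w) = iterated_mean bs f x"
  by (induction bs arbitrary: x) (simp_all add: segment_mean_periodic)

text \<open>For a direction in \<open>bs\<close>, the integration in that direction kills the
  derivative, since the inner mean is still periodic. The outer integrations average a zero
  function, because means commute with derivatives. Linearity of the derivative then gives the whole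
  span.\<close>

lemma iterated_mean_derivative_span:
  fixes f :: "'a::euclidean_space \<Rightarrow> 'b::banach"
  assumes "smooth_on f UNIV" "\<And>b x. b \<in> set bs \<Longrightarrow> f (x + b) = f x" "v \<in> span (set bs)"
  shows "frechet_derivative (iterated_mean bs f) (at x) v = 0"
proof -
  have "frechet_derivative (iterated_mean bs f) (at x) v = 0" if "v \<in> set bs" for v x
    using that assms(2)
  proof (induction bs arbitrary: x)
    case (Cons c bs)
    have "segment_mean c (\<lambda>y. frechet_derivative (iterated_mean bs f) (at y) v) x = 0"
    proof (cases "v = c")
      case True
      then show ?thesis
        using Cons.prems
        by (simp add: segment_mean_derivative_period smooth_on_iterated_mean assms(1)
            iterated_mean_periodic)
    next
      case False
      then show ?thesis
        using Cons by (simp add: segment_mean_def)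
    qed
    then show ?case
      by (simp add: frechet_derivative_segment_mean smooth_on_iterated_mean assms(1))
  qed simp
  then show ?thesis
    using linear_eq_0_on_span[OF linear_frechet_derivative _ assms(3)]
      smooth_on_imp_differentiable[OF smooth_on_iterated_mean[OF assms(1)] UNIV_I] by blast
qed

text \<open>The mean only sees values of \<open>f\<close> on \<open>x\<close> plus the span.
  Assuming the bound on this entire affine subspace lets the base point move along \<open>b\<close>
  in the induction.\<close>

lemma iterated_mean_upper_bound:
  fixes f :: "'a::euclidean_space \<Rightarrow> real"
  assumes "smooth_on f UNIV" "\<And>v. v \<in> span (set bs) \<Longrightarrow> f (x + v) \<le> C"
  shows "iterated_mean bs f x \<le> C"
  using assms(2)
proof (induction bs arbitrary: x)
  case Nil
  then show ?case
    using Nil[of 0] by simp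
next
  case (Cons b bs)
  have "iterated_mean bs f (x + t *\<^sub>R b) \<le> C" for t
  proof (rule Cons.IH)
    fix v assume "v \<in> span (set bs)"
    then have "v \<in> span (set (b # bs))"
      by (rule subsetD[OF span_mono, rotated]) auto
    moreover have "t *\<^sub>R b \<in> span (set (b # bs))"
      by (intro span_scale span_base) simp
    ultimately have "t *\<^sub>R b + v \<in> span (set (b # bs))"
      by (simp only: span_add)
    from Cons.prems[OF this] show "f (x + t *\<^sub>R b + v) \<le> C"
      by (simp add: add.assoc)
  qed
  then show ?case
    by (simp add: segment_mean_upper_bound smooth_on_imp_continuous_on smooth_on_iterated_mean
        assms(1))
qed

lemma iterated_mean_pos:
  fixes f :: "'a::euclidean_space \<Rightarrow> real"
  assumes "smooth_on f UNIV" "\<And>x. 0 < f x"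
  shows "0 < iterated_mean bs f x"
  by (induction bs arbitrary: x)
    (simp_all add: segment_mean_pos smooth_on_imp_continuous_on smooth_on_iterated_mean assms)

section \<open>Wirtinger derivatives and pluriclosed metrics\<close>

text \<open>Harmonicity of \<open>f\<close> is expressed by holomorphy of
  \<open>fx - \<i> fy\<close>. A primitive \<open>K\<close> of it on the plane satisfies
  \<open>f = Re K + c\<close>, and \<open>exp (- K)\<close> is a bounded entire function, hence
  constant.\<close>

lemma nonneg_harmonic_constant:
  fixes f fx fy :: "complex \<Rightarrow> real"
  assumes "\<And>z. (f has_derivative (\<lambda>h. fx z * Re h + fy z * Im h)) (at z)"
    and "(\<lambda>z. Complex (fx z) (- fy z)) holomorphic_on UNIV"
    and "\<And>z. 0 \<le> f z"
  shows "f z = f w"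
proof -
  obtain K where K: "\<And>z. (K has_field_derivative Complex (fx z) (- fy z)) (at z)"
    using holomorphic_convex_primitive'[OF convex_UNIV open_UNIV assms(2)] by auto
  have "((\<lambda>z. f z - Re (K z)) has_derivative (\<lambda>h. 0)) (at z)" for z
    using has_derivative_diff[OF assms(1)
        bounded_linear.has_derivative[OF bounded_linear_Re, OF K[unfolded has_field_derivative_def]]]
    by simp
  then obtain c where "\<And>z. f z - Re (K z) = c"
    using has_derivative_zero_constant[OF convex_UNIV, of "\<lambda>z. f z - Re (K z)"] by auto
  then have f: "f z = Re (K z) + c" for z
    by (metis diff_add_cancel add.commute)
  have "(\<lambda>z. exp (- K z)) holomorphic_on UNIV"
    using K by (intro holomorphic_intros) (auto simp: holomorphic_on_def field_differentiable_def)
  \<comment> \<open>The modulus is \<open>exp (- Re (K z)) = exp (c - f z)\<close>, and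
    \<open>f z\<close> is nonnegative.\<close>
  moreover have "norm (exp (- K z)) \<le> exp c" for z
    using assms(3)[of z] f[of z] by (simp add: norm_exp_eq_Re)
  then have "bounded (range (\<lambda>z. exp (- K z)))"
    by (auto simp: bounded_iff)
  ultimately have "(\<lambda>z. exp (- K z)) constant_on UNIV"
    by (rule Liouville_theorem)
  then have "exp (- K z) = exp (- K w)"
    by (auto simp: constant_on_def)
  then have "Re (K z) = Re (K w)"
    by (metis exp_inj_iff neg_equal_iff_equal norm_exp_eq_Re uminus_complex.sel(1))
  then show ?thesis
    by (simp add: f)
qed

section \<open>Forms in low degree and calculus of Wirtinger derivatives\<close>

lemma shuffle_sign_empty: "shuffle_sign I {} = 1"
  by (simp add: shuffle_sign_def)

lemma wedge_power_1: "wedge_power \<alpha> (Suc 0) = \<alpha>"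
proof (intro ext)
  fix I J x
  have "wedge \<alpha> unit_form I J x = (\<Sum>I'\<in>Pow I. \<Sum>J'\<in>Pow J.
      if I' = I \<and> J' = J then \<alpha> I J x else 0)"
    unfolding wedge_def
    by (intro sum.cong refl) (auto simp: unit_form_def shuffle_sign_empty)
  also have "\<dots> = (\<Sum>I'\<in>Pow I. if I' = I then \<alpha> I J x else 0)"
    by (intro sum.cong refl) (auto simp: if_distrib cong: if_cong)
  also have "\<dots> = \<alpha> I J x"
    by simp
  finally show "wedge_power \<alpha> (Suc 0) I J x = \<alpha> I J x"
    by simp
qed

lemma shuffle_sign_singletons: "shuffle_sign {i} {k} = (if k < i then - 1 else 1)"
proof -
  have "{(i', k'). i' \<in> {i} \<and> k' \<in> {k} \<and> k' < i'} = (if k < i then {(i, k)} else {})"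
    by auto
  then show ?thesis
    by (simp add: shuffle_sign_def)
qed

lemma d_zbar_cmult:
  assumes "f differentiable (at x)"
  shows "d_zbar j (\<lambda>x. c * f x) x = c * d_zbar j f x"
  unfolding d_zbar_def frechet_derivative_bounded_linear[OF bounded_linear_mult_right assms]
  by (simp add: algebra_simps)

lemma d_z_cmult:
  assumes "f differentiable (at x)"
  shows "d_z j (\<lambda>x. c * f x) x = c * d_z j f x"
  unfolding d_z_def frechet_derivative_bounded_linear[OF bounded_linear_mult_right assms]
  by (simp add: algebra_simps)

text \<open>A sum of constant multiples of directional derivatives, the shape to which the rules for
  smoothness and means of sums and multiples apply.\<close>

lemma d_z_eq:
  "d_z j f = (\<lambda>x. (1/2) * frechet_derivative f (at x) (axis j 1) +
     (-\<i>/2) * frechet_derivative f (at x) (axis j \<i>))"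
  by (simp add: d_z_def fun_eq_iff field_simps)

lemma d_zbar_eq:
  "d_zbar j f = (\<lambda>x. (1/2) * frechet_derivative f (at x) (axis j 1) +
     (\<i>/2) * frechet_derivative f (at x) (axis j \<i>))"
  by (simp add: d_zbar_def fun_eq_iff field_simps)

lemma smooth_on_d_zbar: "smooth_on f UNIV \<Longrightarrow> smooth_on (d_zbar j f) UNIV"
  unfolding d_zbar_eq by (intro smooth_on_add smooth_on_bounded_linear[OF bounded_linear_mult_right]
      smooth_on_frechet_derivative)

lemma smooth_on_d_z: "smooth_on f UNIV \<Longrightarrow> smooth_on (d_z j f) UNIV"
  unfolding d_z_eq by (intro smooth_on_add smooth_on_bounded_linear[OF bounded_linear_mult_right]
      smooth_on_frechet_derivative)

lemma d_z_add:
  assumes "f differentiable (at x)" "g differentiable (at x)"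
  shows "d_z j (\<lambda>x. f x + g x) x = d_z j f x + d_z j g x"
  using assms by (simp add: d_z_def frechet_derivative_add field_simps)

lemma iterated_mean_cmult_derivative:
  fixes f :: "'a::euclidean_space \<Rightarrow> complex"
  assumes "smooth_on f UNIV"
  shows "iterated_mean bs (\<lambda>x. c * frechet_derivative f (at x) v) =
    (\<lambda>x. c * frechet_derivative (iterated_mean bs f) (at x) v)"
  by (simp add: iterated_mean_bounded_linear[OF bounded_linear_mult_right]
      smooth_on_frechet_derivative frechet_derivative_iterated_mean assms)

lemma iterated_mean_d_zbar:
  assumes "smooth_on f UNIV"
  shows "iterated_mean bs (d_zbar j f) = d_zbar j (iterated_mean bs f)"
  unfolding d_zbar_eq
  by (rule trans[OF iterated_mean_add], (intro smooth_on_bounded_linear[OF bounded_linear_mult_right]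
      smooth_on_frechet_derivative assms)+) (simp only: iterated_mean_cmult_derivative[OF assms])

lemma iterated_mean_d_z:
  assumes "smooth_on f UNIV"
  shows "iterated_mean bs (d_z j f) = d_z j (iterated_mean bs f)"
  unfolding d_z_eq
  by (rule trans[OF iterated_mean_add], (intro smooth_on_bounded_linear[OF bounded_linear_mult_right]
      smooth_on_frechet_derivative assms)+) (simp only: iterated_mean_cmult_derivative[OF assms])

text \<open>The two derivatives, each removing one index from \<open>{p, q}\<close>, expand the
  coefficient into four terms. The sign \<open>s\<close>, which depends on the order of
  \<open>p\<close> and \<open>q\<close>, occurs once in \<open>del\<close> and once in
  \<open>delbar\<close>, so only \<open>s * s = 1\<close> remains.\<close>

lemma pluriclosed_equation:
  fixes H :: "'n::{finite,linorder} cvec \<Rightarrow> 'n cmat"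
  assumes smooth: "smooth_on H UNIV" and "p \<noteq> q"
    and closed: "del (delbar (fundamental_form H)) {p, q} {p, q} x = 0"
  shows "d_z p (d_zbar p (\<lambda>y. H y $ q $ q)) x + d_z q (d_zbar q (\<lambda>y. H y $ p $ p)) x =
    d_z p (d_zbar q (\<lambda>y. H y $ q $ p)) x + d_z q (d_zbar p (\<lambda>y. H y $ p $ q)) x"
proof -
  note comp = smooth_on_matrix_entry[OF smooth]
  define s where "s = shuffle_sign {p} {q}"
  have s: "shuffle_sign {q} {p} = - s" "s * s = 1"
    using \<open>p \<noteq> q\<close> by (auto simp: s_def shuffle_sign_singletons)
  have sets: "{p, q} - {p} = {q}" "{p, q} - {q} = {p}"
    using \<open>p \<noteq> q\<close> by auto
  have "fundamental_form H {i} {k} = (\<lambda>y. \<i> / 2 * H y $ i $ k)" for i k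
    by (simp add: fundamental_form_def fun_eq_iff)
  then have ff: "d_zbar j (fundamental_form H {i} {k}) x = \<i> / 2 * d_zbar j (\<lambda>y. H y $ i $ k) x"
    for i j k x
    by (simp only: d_zbar_cmult[OF smooth_on_imp_differentiable[OF comp UNIV_I]])
  have db: "delbar (fundamental_form H) {i} {p, q} =
      (\<lambda>x. (- (s * \<i> / 2)) * d_zbar p (\<lambda>y. H y $ i $ q) x + (s * \<i> / 2) * d_zbar q (\<lambda>y. H y $ i $ p) x)" for i
    using \<open>p \<noteq> q\<close>
    by (simp add: delbar_def sets s ff fun_eq_iff mult.assoc flip: s_def)
  have diff: "(\<lambda>x. c * d_zbar j (\<lambda>y. H y $ i $ k) x) differentiable (at x)"
    "d_zbar j (\<lambda>y. H y $ i $ k) differentiable (at x)" for c j i k x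
    using smooth_on_d_zbar[OF comp]
    by (auto intro!: smooth_on_imp_differentiable[of _ UNIV]
        smooth_on_bounded_linear[OF bounded_linear_mult_right])
  have "0 = s * d_z p (delbar (fundamental_form H) {q} {p, q}) x -
      s * d_z q (delbar (fundamental_form H) {p} {p, q}) x"
    using \<open>p \<noteq> q\<close> closed by (simp add: del_def sets s flip: s_def)
  also have "\<dots> = (s * s) * (- \<i> / 2) *
      (d_z p (d_zbar p (\<lambda>y. H y $ q $ q)) x + d_z q (d_zbar q (\<lambda>y. H y $ p $ p)) x
      - d_z p (d_zbar q (\<lambda>y. H y $ q $ p)) x - d_z q (d_zbar p (\<lambda>y. H y $ p $ q)) x)"
    unfolding db d_z_add[OF diff(1,1)] d_z_cmult[OF diff(2)]
    by (simp add: algebra_simps)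
  finally show ?thesis
    by (simp add: s(2) diff_diff_eq)
qed

section \<open>Lifting a metric from the quotient\<close>

lemma delbar_cong_open:
  assumes "open S" "\<And>I J y. y \<in> S \<Longrightarrow> \<alpha> I J y = \<beta> I J y" "x \<in> S"
  shows "delbar \<alpha> I J x = delbar \<beta> I J x"
proof -
  have "frechet_derivative (\<alpha> I K) (at x) = frechet_derivative (\<beta> I K) (at x)" for K
    using assms by (intro frechet_derivative_cong_open)
  then show ?thesis
    by (simp add: delbar_def d_zbar_def)
qed

lemma del_cong_open:
  assumes "open S" "\<And>I J y. y \<in> S \<Longrightarrow> \<alpha> I J y = \<beta> I J y" "x \<in> S"
  shows "del \<alpha> I J x = del \<beta> I J x"
proof -
  have "frechet_derivative (\<alpha> K J) (at x) = frechet_derivative (\<beta> K J) (at x)" for K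
    using assms by (intro frechet_derivative_cong_open)
  then show ?thesis
    by (simp add: del_def d_z_def)
qed

definition nakamura_chart ::
  "(complex \<times> 2 cvec) set \<Rightarrow> (complex \<times> 2 cvec) set \<Rightarrow> ((complex \<times> 2 cvec) set, 3) chart" where
  "nakamura_chart \<Gamma> V = (nakamura_proj \<Gamma> ` V, nakamura_coords \<circ> inv_into V (nakamura_proj \<Gamma>))"

context
  fixes \<Gamma> assumes sub: "subgroup \<Gamma> nakamura_group" and disc: "discrete \<Gamma>"
begin

text \<open>Near \<open>g\<close> the transition between the two charts is left translation by
  \<open>\<gamma>\<close>, which is affine in the global coordinates with constant Jacobian
  \<open>nakamura_jacobian (fst \<gamma>)\<close>.\<close>

lemma hermitian_metric_nakamura_chart:
  assumes h: "hermitian_metric (nakamura_atlas \<Gamma>) h"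
    and V: "open V" "inj_on (nakamura_proj \<Gamma>) V" and W: "open W" "inj_on (nakamura_proj \<Gamma>) W"
    and g: "g \<in> V" "\<gamma> \<in> \<Gamma>" "nakamura_mult \<gamma> g \<in> W"
  shows "h (nakamura_chart \<Gamma> V) (nakamura_coords g) = transpose (nakamura_jacobian (fst \<gamma>)) **
    h (nakamura_chart \<Gamma> W) (nakamura_coords (nakamura_mult \<gamma> g)) **
    (\<chi> j k. cnj (nakamura_jacobian (fst \<gamma>) $ j $ k))"
proof -
  have proj: "nakamura_proj \<Gamma> (nakamura_mult \<gamma>' g) = nakamura_proj \<Gamma> g" if "\<gamma>' \<in> \<Gamma>" for \<gamma>'
    using nakamura_proj_eq_iff_ex[OF sub disc] that by blast
  have gW: "nakamura_proj \<Gamma> g \<in> nakamura_proj \<Gamma> ` W"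
    using proj[OF g(2)] g(3) by (metis imageI)
  obtain \<gamma>' where \<gamma>': "\<gamma>' \<in> \<Gamma>" "nakamura_mult \<gamma>' g \<in> W"
    "(transition (nakamura_chart \<Gamma> V) (nakamura_chart \<Gamma> W) has_derivative
      (*v) (nakamura_jacobian (fst \<gamma>'))) (at (nakamura_coords g))"
    using nakamura_transition_derivative[OF sub disc V W g(1) gW]
    unfolding nakamura_chart_def by blast
  \<comment> \<open>The transition lemma only supplies some element \<open>\<gamma>'\<close>; both
    translates of \<open>g\<close> lie in \<open>W\<close>, where the projection is injective, so it
    is the given one.\<close>
  have "nakamura_mult \<gamma>' g = nakamura_mult \<gamma> g"
    using inj_onD[OF W(2)] proj \<gamma>' g by metis
  then have eq: "\<gamma>' = \<gamma>"
    using nakamura.right_cancel[of g \<gamma>' \<gamma>] by simp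
  have J: "jacobian (transition (nakamura_chart \<Gamma> V) (nakamura_chart \<Gamma> W)) (at (nakamura_coords g))
      = nakamura_jacobian (fst \<gamma>)"
    unfolding jacobian_def frechet_derivative_at[OF \<gamma>'(3), symmetric] eq by simp
  have "nakamura_chart \<Gamma> V \<in> nakamura_atlas \<Gamma>" "nakamura_chart \<Gamma> W \<in> nakamura_atlas \<Gamma>"
    using V W by (auto simp: nakamura_chart_def nakamura_atlas_def)
  moreover have "nakamura_proj \<Gamma> g \<in> fst (nakamura_chart \<Gamma> V) \<inter> fst (nakamura_chart \<Gamma> W)"
    using g(1) gW by (simp add: nakamura_chart_def)
  moreover have "snd (nakamura_chart \<Gamma> V) (nakamura_proj \<Gamma> g) = nakamura_coords g"
    using V(2) g(1) by (simp add: nakamura_chart_def)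
  moreover have "snd (nakamura_chart \<Gamma> W) (nakamura_proj \<Gamma> g) = nakamura_coords (nakamura_mult \<gamma> g)"
    using W(2) g(3) by (simp add: nakamura_chart_def flip: proj[OF g(2)])
  ultimately show ?thesis
    using h J unfolding hermitian_metric_def Let_def by metis
qed

lemma nakamura_jacobian_0: "nakamura_jacobian 0 = mat 1"
  by (simp add: nakamura_jacobian_def[OF sub disc] mat_def vec_eq_iff)

text \<open>The case of the unit element, whose Jacobian is the identity. It makes the pull-back of
  the metric to the group well defined.\<close>

lemma hermitian_metric_nakamura_chart_eq:
  assumes h: "hermitian_metric (nakamura_atlas \<Gamma>) h"
    and V: "open V" "inj_on (nakamura_proj \<Gamma>) V" and W: "open W" "inj_on (nakamura_proj \<Gamma>) W"
    and g: "g \<in> V" "g \<in> W"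
  shows "h (nakamura_chart \<Gamma> V) (nakamura_coords g) = h (nakamura_chart \<Gamma> W) (nakamura_coords g)"
proof -
  have "(0, 0) \<in> \<Gamma>"
    using subgroup.one_closed[OF sub] by simp
  moreover have "(\<chi> j k. cnj (mat 1 $ j $ k)) = (mat 1 :: 3 cmat)"
    by (simp add: mat_def vec_eq_iff)
  ultimately show ?thesis
    using hermitian_metric_nakamura_chart[OF h V W g(1), of "(0, 0)"] g(2)
    by (simp add: nakamura_mult_one nakamura_jacobian_0)
qed

text \<open>\<open>H\<close> is the matrix of the pulled-back metric in the global coordinates of
  the group. Smoothness, positivity and the differential equation are local, and the third property
  is invariance under left translation by \<open>\<Gamma>\<close>.\<close>

lemma astheno_kaehler_lift:
  assumes h: "astheno_kaehler (nakamura_atlas \<Gamma>) h"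
  obtains H :: "3 cvec \<Rightarrow> 3 cmat" where "smooth_on H UNIV" "\<And>x. hermitian_posdef (H x)"
    "\<And>\<gamma> x. \<gamma> \<in> \<Gamma> \<Longrightarrow> H x = transpose (nakamura_jacobian (fst \<gamma>)) **
      H (nakamura_coords \<gamma> + nakamura_jacobian (fst \<gamma>) *v x) **
      (\<chi> j k. cnj (nakamura_jacobian (fst \<gamma>) $ j $ k))"
    "\<And>I J x. del (delbar (fundamental_form H)) I J x = 0"
proof -
  note coords = nakamura_uncoords_coords[OF sub disc]
  have metric: "hermitian_metric (nakamura_atlas \<Gamma>) h"
    using h by (simp add: astheno_kaehler_def)
  obtain N where N: "\<And>g. open (N g)" "\<And>g. g \<in> N g" "\<And>g. inj_on (nakamura_proj \<Gamma>) (N g)"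
  proof -
    have "\<exists>V. open V \<and> g \<in> V \<and> inj_on (nakamura_proj \<Gamma>) V" for g
      using nakamura_proj_inj_nbhd[OF sub disc, of g] by blast
    then show thesis
      using that by metis
  qed
  \<comment> \<open>Each point is read in the chart chosen around that very point; by independence
    of the chart, \<open>H\<close> agrees on the whole neighbourhood \<open>T x\<close> with the
    matrix in the one chart chosen at \<open>x\<close>.\<close>
  define H where "H x = h (nakamura_chart \<Gamma> (N (nakamura_uncoords x))) x" for x
  have H: "H x = h (nakamura_chart \<Gamma> V) x"
    if "open V" "inj_on (nakamura_proj \<Gamma>) V" "nakamura_uncoords x \<in> V" for V x
    using hermitian_metric_nakamura_chart_eq[OF metric N(1,3) that(1,2) N(2) that(3)]
    by (simp add: H_def coords)
  define T where "T x = nakamura_coords ` N (nakamura_uncoords x)" for x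
  let ?c = "\<lambda>x. nakamura_chart \<Gamma> (N (nakamura_uncoords x))"
  have T: "open (T x)" "x \<in> T x" "\<And>y. y \<in> T x \<Longrightarrow> H y = h (?c x) y" for x
  proof -
    show "open (T x)"
      unfolding T_def by (rule open_nakamura_coords[OF sub disc N(1)])
    show "x \<in> T x"
      unfolding T_def using N(2)[of "nakamura_uncoords x"] by (metis coords(2) imageI)
    show "H y = h (?c x) y" if "y \<in> T x" for y
      using that by (intro H N) (auto simp: T_def coords)
  qed
  have atlas: "?c x \<in> nakamura_atlas \<Gamma>" "snd (?c x) ` fst (?c x) = T x" for x
    using N(1,3) nakamura_chart_image[OF sub disc N(3)]
    unfolding nakamura_atlas_def nakamura_chart_def T_def fst_conv snd_conv by blast+
  show thesis
  proof
    show "smooth_on H UNIV"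
      using T metric atlas unfolding hermitian_metric_def
      by (intro smooth_on_local[of _ "\<lambda>x. h (?c x)"]) metis
    show "hermitian_posdef (H x)" for x
      using T metric atlas unfolding hermitian_metric_def by metis
    show "H x = transpose (nakamura_jacobian (fst \<gamma>)) **
      H (nakamura_coords \<gamma> + nakamura_jacobian (fst \<gamma>) *v x) **
      (\<chi> j k. cnj (nakamura_jacobian (fst \<gamma>) $ j $ k))" if "\<gamma> \<in> \<Gamma>" for \<gamma> x
      using hermitian_metric_nakamura_chart[OF metric N(1,3) N(1,3) N(2) that N(2), of "nakamura_uncoords x"]
      by (simp add: H_def coords flip: nakamura_mult_affine[OF sub disc])
    show "del (delbar (fundamental_form H)) I J x = 0" for I J x
    proof -
      have "del (delbar (fundamental_form H)) I J x = del (delbar (fundamental_form (h (?c x)))) I J x"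
        using T by (intro del_cong_open[OF T(1)] delbar_cong_open[OF T(1)])
          (auto simp: fundamental_form_def)
      also have "\<dots> = 0"
      proof -
        have card: "CARD(3) - 2 = Suc 0"
          by simp
        have x: "x \<in> snd (?c x) ` fst (?c x)"
          using T(2)[of x] by (simp only: atlas(2))
        show ?thesis
          using bspec[OF bspec[OF conjunct2[OF h[unfolded astheno_kaehler_def]] atlas(1)] x]
          unfolding card wedge_power_1 by blast
      qed
      finally show ?thesis .
    qed
  qed
qed

end

section \<open>Lattices and positive harmonic functions\<close>

lemma basis_subset_int_combinations:
  assumes "finite B" "L = {\<Sum>b\<in>B. of_int (k b) *\<^sub>R b | k :: 'a::euclidean_space \<Rightarrow> int. True}"
  shows "B \<subseteq> L"
proof
  fix b assume "b \<in> B"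
  then have "b = (\<Sum>c\<in>B. of_int (if c = b then 1 else 0) *\<^sub>R c)"
    using assms(1) by (simp add: if_distrib[of "\<lambda>r. r *\<^sub>R _"] if_distrib[of of_int] cong: if_cong)
  then show "b \<in> L"
    unfolding assms(2) by (intro CollectI exI conjI TrueI)
qed

lemma vector_lattice_cobounded:
  assumes "vector_lattice L"
  obtains R where "\<And>w. \<exists>l\<in>L. norm (l + w) \<le> R"
proof -
  obtain B where B: "independent B" "span B = UNIV"
    "L = {\<Sum>b\<in>B. of_int (k b) *\<^sub>R b | k. True}"
    using assms unfolding vector_lattice_def by blast
  have fin: "finite B"
    using B(1) by (rule independent_imp_finite)
  have "\<exists>l\<in>L. norm (l + w) \<le> (\<Sum>b\<in>B. norm b)" for w
  proof -
    have "w \<in> span B"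
      using B(2) by simp
    then obtain r where r: "w = (\<Sum>b\<in>B. r b *\<^sub>R b)"
      using span_finite[OF fin] by auto
    \<comment> \<open>Subtracting the integer parts of the coordinates moves \<open>w\<close> into
      the fundamental parallelepiped, whose points have norm at most the sum of the norms of the
      basis vectors.\<close>
    let ?l = "\<Sum>b\<in>B. of_int (- \<lfloor>r b\<rfloor>) *\<^sub>R b"
    have "?l + w = (\<Sum>b\<in>B. frac (r b) *\<^sub>R b)"
      unfolding r sum.distrib[symmetric] by (simp add: frac_def algebra_simps)
    also have "norm \<dots> \<le> (\<Sum>b\<in>B. norm b)"
    proof (rule sum_norm_le)
      fix b
      show "norm (frac (r b) *\<^sub>R b) \<le> norm b"
        using frac_ge_0[of "r b"] frac_lt_1[of "r b"]
        by (simp add: mult_left_le_one_le)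
    qed
    moreover have "?l \<in> L"
      unfolding B(3) by (intro CollectI exI[of _ "\<lambda>b. - \<lfloor>r b\<rfloor>"]) simp
    ultimately show ?thesis
      by metis
  qed
  then show thesis
    using that by blast
qed

text \<open>All values are already attained on a closed ball that meets every translate of the
  lattice.\<close>

lemma continuous_periodic_bounded_above:
  fixes f :: "'a::euclidean_space \<Rightarrow> real"
  assumes "vector_lattice L" "continuous_on UNIV f" "\<And>l w. l \<in> L \<Longrightarrow> f (l + w) = f w"
  obtains C where "\<And>w. f w \<le> C"
proof -
  obtain R where R: "\<And>w. \<exists>l\<in>L. norm (l + w) \<le> R"
    using vector_lattice_cobounded[OF assms(1)] by blast
  have "compact (f ` cball 0 R)"
    using continuous_on_subset[OF assms(2)] by (intro compact_continuous_image) auto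
  then obtain C where C: "\<And>y. y \<in> f ` cball 0 R \<Longrightarrow> norm y \<le> C"
    using compact_imp_bounded bounded_iff by metis
  have "f w \<le> C" for w
  proof -
    obtain l where "l \<in> L" "norm (l + w) \<le> R"
      using R by blast
    then show ?thesis
      using C[of "f (l + w)"] assms(3) by fastforce
  qed
  then show thesis
    by (rule that)
qed

text \<open>A lattice contains a real basis of the plane, and \<open>Re\<close> cannot vanish on all
  of it because \<open>Re 1 = 1\<close>.\<close>

lemma vector_lattice_Re_nonzero:
  assumes "vector_lattice L" obtains z where "z \<in> L" "Re z \<noteq> 0"
proof -
  obtain B where B: "independent B" "span B = UNIV"
    "L = {\<Sum>b\<in>B. of_int (k b) *\<^sub>R b | k. True}"
    using assms unfolding vector_lattice_def by blast
  have "\<exists>b\<in>B. Re b \<noteq> 0"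
  proof (rule ccontr)
    assume "\<not> (\<exists>b\<in>B. Re b \<noteq> 0)"
    then have "Re 1 = 0"
      using linear_eq_0_on_span[OF bounded_linear.linear[OF bounded_linear_Re], of B 1] B(2) by auto
    then show False
      by simp
  qed
  then show thesis
    using that basis_subset_int_combinations[OF independent_imp_finite[OF B(1)] B(3)] by blast
qed

lemma int_span2_scale:
  assumes "z \<in> int_span2 u v"
  shows "of_int k * z \<in> int_span2 u v"
proof -
  obtain m n :: int where "z = of_int m * u + of_int n * v"
    using assms by (auto simp: int_span2_def)
  then have "of_int k * z = of_int (k * m) * u + of_int (k * n) * v"
    by (simp add: algebra_simps)
  then show ?thesis
    unfolding int_span2_def by blast
qed

section \<open>Nonnegative harmonic functions along a coordinate line\<close>

lemma has_derivative_along_axis: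
  fixes f :: "complex^'n::finite \<Rightarrow> complex"
  assumes "smooth_on f UNIV"
  shows "((\<lambda>\<zeta>. f (axis j \<zeta>)) has_derivative
    (\<lambda>h. frechet_derivative f (at (axis j z)) (axis j 1) * Re h +
         frechet_derivative f (at (axis j z)) (axis j \<i>) * Im h)) (at z)"
proof -
  have lin: "bounded_linear (axis j :: complex \<Rightarrow> complex^'n)"
    by (intro linear_conv_bounded_linear[THEN iffD1] linearI) (auto simp: axis_def vec_eq_iff)
  have axis: "axis j h = Re h *\<^sub>R axis j 1 + Im h *\<^sub>R axis j \<i>" for h
    by (auto simp: axis_def vec_eq_iff complex_eq_iff)
  have L: "linear (frechet_derivative f (at (axis j z)))"
    by (intro linear_frechet_derivative smooth_on_imp_differentiable[OF assms] UNIV_I)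
  have eq: "(\<lambda>h. frechet_derivative f (at (axis j z)) (axis j 1) * Re h +
      frechet_derivative f (at (axis j z)) (axis j \<i>) * Im h) =
      (\<lambda>h. frechet_derivative f (at (axis j z)) (axis j h))"
    by (rule ext, subst (3) axis, simp only: linear_add[OF L] linear_cmul[OF L])
      (simp add: scaleR_conv_of_real mult.commute)
  show ?thesis
    unfolding eq
    by (rule has_derivative_compose[OF bounded_linear_imp_has_derivative[OF lin]
        smooth_on_has_derivative[OF assms]])
qed

text \<open>The restriction of \<open>u\<close> to the coordinate line satisfies the hypotheses of
  \<open>nonneg_harmonic_constant\<close>; what must be seen is that the Wirtinger equation gives
  the required holomorphy.\<close>

lemma nonneg_harmonic_axis_constant:
  fixes u :: "complex^'n::finite \<Rightarrow> complex"
  assumes u: "smooth_on u UNIV" "\<And>x. Im (u x) = 0" "\<And>x. 0 \<le> Re (u x)"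
    and harmonic: "\<And>x. d_z j (d_zbar j u) x = 0"
  shows "u (axis j z) = u (axis j w)"
proof -
  let ?D = "\<lambda>v x. frechet_derivative u (at x) v"
  have im: "Im (?D v x) = 0" for v x
  proof -
    have "((\<lambda>x. Im (u x)) has_derivative (\<lambda>v. Im (?D v x))) (at x)"
      by (rule bounded_linear.has_derivative[OF bounded_linear_Im smooth_on_has_derivative[OF u(1)]])
    then have "(\<lambda>v. Im (?D v x)) = (\<lambda>v. 0)"
      unfolding u(2) by (rule has_derivative_unique) simp
    then show ?thesis
      by metis
  qed
  let ?fx = "\<lambda>z. Re (?D (axis j 1) (axis j z))" and ?fy = "\<lambda>z. Re (?D (axis j \<i>) (axis j z))"
  have "((\<lambda>z. Re (u (axis j z))) has_derivative (\<lambda>h. ?fx z * Re h + ?fy z * Im h)) (at z)" for z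
    using bounded_linear.has_derivative[OF bounded_linear_Re has_derivative_along_axis[OF u(1)]]
    by simp
  moreover have "(\<lambda>z. Complex (?fx z) (- ?fy z)) holomorphic_on UNIV"
  proof -
    let ?k = "d_zbar j u"
    \<comment> \<open>Since \<open>u\<close> is real, so are its derivatives, and conjugating
      \<open>d_zbar j u\<close> changes only the sign in front of \<open>\<i>\<close>.\<close>
    have k: "Complex (?fx z) (- ?fy z) = 2 * cnj (?k (axis j z))" for z
      by (simp add: d_zbar_def complex_eq_iff im)
    have "((\<lambda>z. 2 * cnj (?k (axis j z))) has_field_derivative
        2 * cnj (frechet_derivative ?k (at (axis j z)) (axis j 1))) (at z)" for z
    proof -
      let ?E = "\<lambda>v. frechet_derivative ?k (at (axis j z)) v"
      \<comment> \<open>The equation \<open>d_z j (d_zbar j u) = 0\<close> says that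
        \<open>d_zbar j u\<close> is antiholomorphic along the line, so that its conjugate is
        holomorphic.\<close>
      have E: "?E (axis j \<i>) = - \<i> * ?E (axis j 1)"
        using harmonic[of "axis j z"] by (simp add: d_z_def complex_eq_iff)
      have "((\<lambda>z. 2 * cnj (?k (axis j z))) has_derivative
          (\<lambda>h. 2 * cnj (?E (axis j 1) * Re h + ?E (axis j \<i>) * Im h))) (at z)"
        by (intro bounded_linear.has_derivative[OF bounded_linear_mult_right]
            bounded_linear.has_derivative[OF bounded_linear_cnj]
            has_derivative_along_axis smooth_on_d_zbar u(1))
      moreover have "2 * cnj (?E (axis j 1) * Re h + ?E (axis j \<i>) * Im h) =
          2 * cnj (?E (axis j 1)) * h" for h
        unfolding E by (simp add: complex_eq_iff algebra_simps)
      ultimately show ?thesis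
        by (simp add: has_field_derivative_def)
    qed
    then show ?thesis
      unfolding k by (auto simp: holomorphic_on_def field_differentiable_def)
  qed
  ultimately have "Re (u (axis j z)) = Re (u (axis j w))"
    by (rule nonneg_harmonic_constant) (rule u(3))
  then show ?thesis
    by (simp add: complex_eq_iff u(2))
qed

section \<open>The fibre mean of an invariant metric\<close>

text \<open>Needed so that a derivative of a periodic coefficient can itself be averaged over its
  periods.\<close>

lemma frechet_derivative_periodic:
  fixes f :: "'a::real_normed_vector \<Rightarrow> 'b::real_normed_vector"
  assumes "\<And>x. f differentiable (at x)" "\<And>x. f (x + w) = f x"
  shows "frechet_derivative f (at (x + w)) = frechet_derivative f (at x)"
proof -
  have "((\<lambda>y. y + w) has_derivative (\<lambda>v. v)) (at x)"
    by (auto intro!: derivative_eq_intros)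
  moreover have "(f has_derivative frechet_derivative f (at (x + w))) (at (x + w))"
    using assms(1) frechet_derivative_works by blast
  ultimately have "((\<lambda>y. f (y + w)) has_derivative frechet_derivative f (at (x + w))) (at x)"
    by (rule has_derivative_compose)
  then have "(f has_derivative frechet_derivative f (at (x + w))) (at x)"
    by (simp only: assms(2))
  then show ?thesis
    by (rule frechet_derivative_at)
qed

lemma hermitian_posdef_diagonal:
  fixes H :: "('n::finite) cmat"
  assumes "hermitian_posdef H"
  shows "Im (H $ i $ i) = 0" "0 < Re (H $ i $ i)"
proof -
  have "H $ i $ i = cnj (H $ i $ i)"
    using assms unfolding hermitian_posdef_def by blast
  then show "Im (H $ i $ i) = 0"
    by (simp add: complex_eq_iff)
  have "axis i 1 \<noteq> (0 :: 'n cvec)"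
    by (simp add: axis_eq_0_iff)
  then have "0 < Re (\<Sum>j\<in>UNIV. \<Sum>k\<in>UNIV. H $ j $ k * axis i 1 $ j * cnj (axis i 1 $ k))"
    using assms unfolding hermitian_posdef_def by blast
  also have "(\<Sum>j\<in>UNIV. \<Sum>k\<in>UNIV. H $ j $ k * axis i 1 $ j * cnj (axis i 1 $ k)) = H $ i $ i"
  proof -
    have "(\<Sum>k\<in>UNIV. H $ j $ k * axis i 1 $ j * cnj (axis i 1 $ k)) = (if j = i then H $ i $ i else 0)" for j
      by (auto simp: axis_def if_distrib[of cnj] if_distrib[of "(*) _"] cong: if_cong)
    then show ?thesis
      by simp
  qed
  finally show "0 < Re (H $ i $ i)" .
qed

lemma d_z_zero: "d_z j (\<lambda>x. 0) = (\<lambda>x. 0)"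
  by (simp add: d_z_def fun_eq_iff)

text \<open>Average \<open>pluriclosed_equation\<close> over the directions in \<open>bs\<close>.
  Three of its four terms contain a derivative in the \<open>q\<close>-th variable, which the mean
  kills; the remaining one is the claim.\<close>

lemma lattice_mean_harmonic:
  fixes H :: "'n::{finite,linorder} cvec \<Rightarrow> 'n cmat"
  assumes smooth: "smooth_on H UNIV" and pq: "p \<noteq> q"
    and closed: "\<And>x. del (delbar (fundamental_form H)) {p, q} {p, q} x = 0"
    and periodic: "\<And>b x. b \<in> set bs \<Longrightarrow> H (x + b) = H x"
    and span: "axis q 1 \<in> span (set bs)" "axis q \<i> \<in> span (set bs)"
  shows "d_z p (d_zbar p (iterated_mean bs (\<lambda>y. H y $ q $ q))) x = 0"
proof -
  let ?h = "\<lambda>i k y. H y $ i $ k"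
  note comp = smooth_on_matrix_entry[OF smooth]
  have fd: "frechet_derivative (iterated_mean bs f) (at x) (axis q 1) = 0"
    "frechet_derivative (iterated_mean bs f) (at x) (axis q \<i>) = 0"
    if "smooth_on f UNIV" "\<And>b x. b \<in> set bs \<Longrightarrow> f (x + b) = f x" for f :: "'n cvec \<Rightarrow> complex" and x
    using iterated_mean_derivative_span[OF that] span by blast+
  \<comment> \<open>This covers the two terms in which the inner derivative is
    \<open>d_zbar q\<close>.\<close>
  have dbar: "d_zbar q (iterated_mean bs (?h i k)) = (\<lambda>x. 0)" for i k
    using fd[OF comp] periodic by (simp add: d_zbar_def fun_eq_iff)
  \<comment> \<open>In the third term \<open>d_z q\<close> is the outer derivative, so the mean can
    kill it only if the inner expression is periodic as well.\<close>
  have per: "d_zbar p (?h p q) (x + b) = d_zbar p (?h p q) x" if "b \<in> set bs" for x b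
    using frechet_derivative_periodic[of "?h p q" b x] periodic[OF that]
      smooth_on_imp_differentiable[OF comp UNIV_I]
    by (simp add: d_zbar_def)
  have dz: "d_z q (iterated_mean bs (d_zbar p (?h p q))) = (\<lambda>x. 0)"
    using fd[OF smooth_on_d_zbar[OF comp] per] by (simp add: d_z_def fun_eq_iff)
  have "iterated_mean bs (\<lambda>x. d_z p (d_zbar p (?h q q)) x + d_z q (d_zbar q (?h p p)) x) =
      iterated_mean bs (\<lambda>x. d_z p (d_zbar q (?h q p)) x + d_z q (d_zbar p (?h p q)) x)"
    using pluriclosed_equation[OF smooth pq closed] by simp
  then show ?thesis
    using dz by (simp add: iterated_mean_add iterated_mean_d_z iterated_mean_d_zbar smooth_on_d_z
        smooth_on_d_zbar comp dbar d_z_zero fun_eq_iff)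
qed

theorem corollary5p1:
  fixes a b c d :: real and \<Gamma>'' :: "2 cvec set"
  assumes "vector_lattice (int_span2 (Complex a b) (Complex c d))"
    and "conjugate_into_SL4Z (nakamura_phi (Complex a b))"
    and "conjugate_into_SL4Z (nakamura_phi (Complex c d))"
    and "vector_lattice \<Gamma>''"
    and "group_lattice nakamura_group (int_span2 (Complex a b) (Complex c d) \<times> \<Gamma>'')"
  shows "\<not> (\<exists>h. astheno_kaehler
             (nakamura_atlas (int_span2 (Complex a b) (Complex c d) \<times> \<Gamma>'')) h)"
proof
  define \<Lambda> where "\<Lambda> = int_span2 (Complex a b) (Complex c d)"
  assume "\<exists>h. astheno_kaehler (nakamura_atlas (int_span2 (Complex a b) (Complex c d) \<times> \<Gamma>'')) h"
  then obtain h where h: "astheno_kaehler (nakamura_atlas (\<Lambda> \<times> \<Gamma>'')) h"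
    unfolding \<Lambda>_def by blast
  have sub: "subgroup (\<Lambda> \<times> \<Gamma>'') nakamura_group" and disc: "discrete (\<Lambda> \<times> \<Gamma>'')"
    using assms(5) by (auto simp: \<Lambda>_def group_lattice_def)
  note jacobian = nakamura_jacobian_def[OF sub disc]
  obtain H :: "3 cvec \<Rightarrow> 3 cmat" where smooth: "smooth_on H UNIV"
    and posdef: "\<And>x. hermitian_posdef (H x)"
    and equi: "\<And>\<gamma> x. \<gamma> \<in> \<Lambda> \<times> \<Gamma>'' \<Longrightarrow> H x = transpose (nakamura_jacobian (fst \<gamma>)) **
      H (nakamura_coords \<gamma> + nakamura_jacobian (fst \<gamma>) *v x) **
      (\<chi> j k. cnj (nakamura_jacobian (fst \<gamma>) $ j $ k))"
    and closed: "\<And>I J x. del (delbar (fundamental_form H)) I J x = 0"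
    using astheno_kaehler_lift[OF sub disc h] by blast
  have zero: "0 \<in> \<Lambda>" "0 \<in> \<Gamma>''"
    using subgroup.one_closed[OF sub] by simp_all
  \<comment> \<open>The embedding of the fibre over \<open>z = 0\<close> into the coordinate
    space.\<close>
  define \<iota> where "\<iota> w = nakamura_coords (0, w)" for w
  have lin: "linear \<iota>"
    unfolding \<iota>_def by (rule linearI) (auto simp: nakamura_coords_def vec_eq_iff forall_3)
  have coords: "nakamura_coords (z, w) = axis 1 z + \<iota> w" for z w
    by (simp add: \<iota>_def nakamura_coords_def vec_eq_iff forall_3 axis_def)
  \<comment> \<open>The element \<open>(0, w)\<close> has trivial linear part and acts as
    translation by \<open>\<iota> w\<close>.\<close>
  have periodic: "H (x + \<iota> w) = H x" if "w \<in> \<Gamma>''" for x w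
  proof -
    have "(\<chi> j k. cnj (mat 1 $ j $ k)) = (mat 1 :: 3 cmat)"
      by (simp add: mat_def vec_eq_iff)
    then show ?thesis
      using equi[of "(0, w)" x] zero that
      by (simp add: nakamura_jacobian_0[OF sub disc] \<iota>_def add.commute)
  qed
  \<comment> \<open>The coefficient belonging to the coordinate \<open>w_2\<close>, which left
    translation by \<open>(z, 0)\<close> multiplies by \<open>exp (- z)\<close>.\<close>
  define f where "f x = H x $ 3 $ 3" for x
  have f_smooth: "smooth_on f UNIV"
    unfolding f_def by (rule smooth_on_matrix_entry[OF smooth])
  have f_smooth_Re: "smooth_on (\<lambda>x. Re (f x)) UNIV"
    using smooth_on_bounded_linear[OF bounded_linear_Re f_smooth] .
  have f_equi: "Re (f (axis 1 z + \<iota> w)) = exp (2 * Re z) * Re (f (\<iota> (nakamura_phi (- z) *v w)))"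
    if "z \<in> \<Lambda>" for z w
  proof -
    \<comment> \<open>Translation by \<open>(z, 0)\<close> carries the fibre over 0 onto the fibre
      over \<open>z\<close>; this is the preimage of the given point.\<close>
    have "nakamura_coords (z, 0) + nakamura_jacobian z *v \<iota> (nakamura_phi (- z) *v w) = axis 1 z + \<iota> w"
      unfolding nakamura_phi_mult
      by (simp add: \<iota>_def nakamura_coords_def jacobian vec_eq_iff forall_3
          matrix_vector_mult_def sum_3 axis_def exp_minus)
    then have "f (\<iota> (nakamura_phi (- z) *v w)) = exp (- z) * f (axis 1 z + \<iota> w) * cnj (exp (- z))"
      using equi[of "(z, 0)" "\<iota> (nakamura_phi (- z) *v w)"] that zero
      by (simp add: f_def jacobian transpose_def matrix_matrix_mult_def sum_3)
    also have "\<dots> = of_real (exp (- Re z) ^ 2) * f (axis 1 z + \<iota> w)"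
      using complex_norm_square[of "exp (- z)"] by (simp add: norm_exp_eq_Re mult_ac)
    finally have Re_f: "Re (f (\<iota> (nakamura_phi (- z) *v w))) = exp (- Re z) ^ 2 * Re (f (axis 1 z + \<iota> w))"
      by (simp only: times_complex.sel Re_complex_of_real Im_complex_of_real mult_zero_left diff_zero)
    have "exp (2 * Re z) * exp (- Re z) ^ 2 = 1"
      unfolding exp_double[of "- Re z", symmetric] exp_add[symmetric] by simp
    then show ?thesis
      unfolding Re_f by (simp only: mult.assoc[symmetric] mult_1)
  qed
  have cont: "continuous_on UNIV (\<lambda>w. Re (f (\<iota> w)))"
    using lin by (intro continuous_on_compose2[OF smooth_on_imp_continuous_on[OF f_smooth_Re]])
      (auto simp: linear_continuous_on linear_conv_bounded_linear)
  have "Re (f (\<iota> (l + w))) = Re (f (\<iota> w))" if "l \<in> \<Gamma>''" for l w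
    using periodic[OF that, of "\<iota> w"] by (simp add: f_def linear_add[OF lin] add.commute)
  \<comment> \<open>\<open>C\<close> bounds \<open>f\<close> on the fibre over 0, which is compact
    modulo \<open>\<Gamma>''\<close>.\<close>
  then obtain C where C: "\<And>w. Re (f (\<iota> w)) \<le> C"
    using continuous_periodic_bounded_above[OF assms(4) cont] by metis
  obtain B where B: "independent B" "span B = UNIV"
    "\<Gamma>'' = {\<Sum>b\<in>B. of_int (k b) *\<^sub>R b | k. True}"
    using assms(4) unfolding vector_lattice_def by blast
  have "finite B"
    using B(1) by (rule independent_imp_finite)
  \<comment> \<open>Averaging runs over a basis of \<open>\<Gamma>''\<close> placed in the fibre, so
    its real span is the whole fibre and contains both real directions of the third
    coordinate.\<close>
  then obtain bs where bs: "set bs = \<iota> ` B"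
    using finite_list[of "\<iota> ` B"] by auto
  have span_bs: "span (set bs) = range \<iota>"
    unfolding bs using linear_span_image[OF lin, of B] B(2) by simp
  define u where "u = iterated_mean bs f"
  have u_Re: "Re (u x) = iterated_mean bs (\<lambda>x. Re (f x)) x" for x
    using iterated_mean_bounded_linear[OF bounded_linear_Re f_smooth] by (simp add: u_def)
  have u_pos: "0 < Re (u x)" for x
    unfolding u_Re using hermitian_posdef_diagonal(2)[OF posdef]
    by (intro iterated_mean_pos f_smooth_Re) (simp add: f_def)
  have u_Im: "Im (u x) = 0" for x
  proof -
    have "(\<lambda>x. Im (f x)) = (\<lambda>x. 0)"
      using hermitian_posdef_diagonal(1)[OF posdef] by (simp add: f_def)
    then show ?thesis
      using iterated_mean_bounded_linear[OF bounded_linear_Im f_smooth, of bs]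
      by (simp add: u_def iterated_mean_zero fun_eq_iff)
  qed
  \<comment> \<open>The indices are \<open>p = 1\<close> for the base and \<open>q = 3\<close> for
    \<open>w_2\<close>.\<close>
  have "d_z 1 (d_zbar 1 u) x = 0" for x
    unfolding u_def f_def
  proof (rule lattice_mean_harmonic[OF smooth _ closed])
    show "H (y + b) = H y" if "b \<in> set bs" for b y
      using that periodic basis_subset_int_combinations[OF \<open>finite B\<close> B(3)] by (auto simp: bs)
    have "axis 3 \<zeta> = \<iota> (vector [0, \<zeta>])" for \<zeta>
      by (simp add: \<iota>_def nakamura_coords_def vec_eq_iff forall_3 axis_def)
    then show "axis 3 1 \<in> span (set bs)" "axis 3 \<i> \<in> span (set bs)"
      unfolding span_bs by auto
  qed simp
  then have const: "u (axis 1 z) = u (axis 1 0)" for z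
    using smooth_on_iterated_mean[OF f_smooth, of bs]
    by (intro nonneg_harmonic_axis_constant u_Im less_imp_le[OF u_pos]) (simp_all add: u_def)
  \<comment> \<open>Being constant along the base, the mean at 0 may be computed over any lattice
    point \<open>z\<close>, where \<open>f_equi\<close> bounds \<open>f\<close> on the entire
    fibre.\<close>
  have bound: "Re (u (axis 1 0)) \<le> exp (2 * Re z) * C" if "z \<in> \<Lambda>" for z
  proof -
    have "Re (f (axis 1 z + v)) \<le> exp (2 * Re z) * C" if v: "v \<in> span (set bs)" for v
      using v f_equi[OF \<open>z \<in> \<Lambda>\<close>] C unfolding span_bs by auto
    then have "Re (u (axis 1 z)) \<le> exp (2 * Re z) * C"
      unfolding u_Re by (rule iterated_mean_upper_bound[OF f_smooth_Re])
    then show ?thesis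
      by (simp add: const[of z])
  qed
  define m where "m = Re (u (axis 1 0))"
  have m: "0 < m" "0 < C"
    using u_pos[of "axis 1 0"] bound[OF zero(1)] unfolding m_def by simp_all
  obtain z where z: "z \<in> \<Lambda>" "Re z \<noteq> 0"
    using vector_lattice_Re_nonzero[OF assms(1)] unfolding \<Lambda>_def by blast
  \<comment> \<open>Chosen so that \<open>exp (- 2 * n * \<bar>Re z\<bar>)\<close> is less than
    \<open>m / C\<close>.\<close>
  obtain n :: nat where n: "ln (C / m) < real n * (2 * \<bar>Re z\<bar>)"
    using reals_Archimedean3[of "2 * \<bar>Re z\<bar>"] z(2) by auto
  \<comment> \<open>The sign makes the real part of \<open>k * z\<close> equal to
    \<open>- n * \<bar>Re z\<bar>\<close>, so the bound at this lattice point falls below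
    \<open>m\<close>.\<close>
  define k :: int where "k = (if Re z > 0 then - int n else int n)"
  have "of_int k * z \<in> \<Lambda>"
    using z(1) int_span2_scale unfolding \<Lambda>_def by blast
  from bound[OF this] have "m / C \<le> exp (2 * Re (of_int k * z))"
    using m(2) by (simp only: pos_divide_le_eq m_def)
  then have "ln (m / C) \<le> ln (exp (2 * Re (of_int k * z)))"
    using m by (subst ln_le_cancel_iff) simp_all
  also have "\<dots> = 2 * Re (of_int k * z)"
    by (rule ln_exp)
  also have "\<dots> = 2 * (real_of_int k * Re z)"
    by simp
  also have "real_of_int k * Re z = - (real n * \<bar>Re z\<bar>)"
    unfolding k_def by simp
  finally have "ln (m / C) \<le> 2 * - (real n * \<bar>Re z\<bar>)" .
  moreover have "ln (m / C) = - ln (C / m)"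
    using m by (simp add: ln_div)
  ultimately show False
    using n by linarith
qed

end
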